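(* Let $\Sigma$ be a non-empty set of prime numbers, let $\mathcal{F}$ be a (possibly infinitely generated) free pro-$\Sigma$ group with a free generating set $\mathcal{X}$, and let $m\geq 2$ be an integer. Then, for every nonzero integer $n\in\mathbb{Z}$ and every $x\in\mathcal{X}$, $$C_{\mathcal{F}^{m}}(x^{n})=\overline{\langle x\rangle},$$ where $x$ is identified with its image in $\mathcal{F}^{m}$. In particular, $\mathcal{F}^{m}$ is slim if $\mathcal{F}\not\cong\mathbb{Z}_{\Sigma}$.
   Context: Pro-$\Sigma$ groups are inverse limits of finite groups whose orders have all prime factors in $\Sigma$; $\mathbb{Z}_\Sigma=\prod_{\ell\in\Sigma}\mathbb{Z}_\ell$. Free pro-$\Sigma$ groups are taken in the standard sense: $\mathcal{F}$ is free pro-$\Sigma$ on a set $\mathcal{X}$ converging to $1$ (every open subgroup contains all but finitely many elements of $\mathcal{X}$; no condition when $\mathcal{X}$ is finite). The topological derived series of a profinite group $G$ is $G^{[0]}=G$, $G^{[m]}=\overline{[G^{[m-1]},G^{[m-1]}]}$ (closed subgroup topologically generated by commutators) for $m\ge1$, and the maximal $m$-step solvable quotient is $G^{m}:=G/G^{[m]}$. For a subset $S\subset G$, $C_G(S)=\{g\in G\mid gs=sg\ \forall s\in S\}$ is the centralizer, with $C_G(x)=C_G(\{x\})$; $\overline{\langle x\rangle}$ is the closed subgroup topologically generated by $x$ (here inside $\mathcal{F}^m$). A profinite group $G$ is slim if $C_G(H)=1$ for every open subgroup $H\subset G$. *)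

theory Defs
  imports "HOL-Algebra.Product_Groups" "HOL-Analysis.Analysis"
begin

definition topological_group :: "('a, 'b) monoid_scheme \<Rightarrow> 'a topology \<Rightarrow> bool" where
  "topological_group G T \<longleftrightarrow>
     group G \<and> topspace T = carrier G \<and>
     continuous_map (prod_topology T T) T (\<lambda>(x, y). x \<otimes>\<^bsub>G\<^esub> y) \<and>
     continuous_map T T (m_inv G)"

definition topological_hom ::
    "('a, 'c) monoid_scheme \<Rightarrow> 'a topology \<Rightarrow> ('b, 'd) monoid_scheme \<Rightarrow> 'b topology \<Rightarrow> ('a \<Rightarrow> 'b) set" where
  "topological_hom G T H S = {f \<in> hom G H. continuous_map T S f}"

definition topologically_isomorphic ::
    "('a, 'c) monoid_scheme \<Rightarrow> 'a topology \<Rightarrow> ('b, 'd) monoid_scheme \<Rightarrow> 'b topology \<Rightarrow> bool" where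
  "topologically_isomorphic G T H S \<longleftrightarrow> (\<exists>f \<in> iso G H. homeomorphic_map T S f)"

definition topologically_generated :: "('a, 'b) monoid_scheme \<Rightarrow> 'a topology \<Rightarrow> 'a set \<Rightarrow> 'a set" where
  "topologically_generated G T S = T closure_of (generate G S)"

definition centralizer :: "('a, 'b) monoid_scheme \<Rightarrow> 'a set \<Rightarrow> 'a set" where
  "centralizer G S = {g \<in> carrier G. \<forall>s\<in>S. g \<otimes>\<^bsub>G\<^esub> s = s \<otimes>\<^bsub>G\<^esub> g}"

definition slim :: "('a, 'b) monoid_scheme \<Rightarrow> 'a topology \<Rightarrow> bool" where
  "slim G T \<longleftrightarrow> (\<forall>H. subgroup H G \<and> openin T H \<longrightarrow> centralizer G H = {\<one>\<^bsub>G\<^esub>})"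

definition quotient_topology :: "('a, 'b) monoid_scheme \<Rightarrow> 'a topology \<Rightarrow> 'a set \<Rightarrow> 'a set topology" where
  "quotient_topology G T N =
     topology (\<lambda>U. U \<subseteq> carrier (G Mod N) \<and> openin T {x \<in> carrier G. N #>\<^bsub>G\<^esub> x \<in> U})"

lemma openin_quotient_topology:
  assumes "topspace T = carrier G"
  shows "openin (quotient_topology G T N) U \<longleftrightarrow>
           U \<subseteq> carrier (G Mod N) \<and> openin T {x \<in> carrier G. N #>\<^bsub>G\<^esub> x \<in> U}"
proof -
  let ?P = "\<lambda>U. U \<subseteq> carrier (G Mod N) \<and> openin T {x \<in> carrier G. N #>\<^bsub>G\<^esub> x \<in> U}"
  have "istopology ?P"
    unfolding istopology_def
  proof (intro conjI allI impI)
    fix A B assume A: "?P A" and B: "?P B"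
    show "A \<inter> B \<subseteq> carrier (G Mod N)" using A by blast
    have "{x \<in> carrier G. N #>\<^bsub>G\<^esub> x \<in> A \<inter> B}
        = {x \<in> carrier G. N #>\<^bsub>G\<^esub> x \<in> A} \<inter> {x \<in> carrier G. N #>\<^bsub>G\<^esub> x \<in> B}" by blast
    then show "openin T {x \<in> carrier G. N #>\<^bsub>G\<^esub> x \<in> A \<inter> B}"
      using A B by (simp add: openin_Int)
  next
    fix K assume K: "\<forall>A\<in>K. ?P A"
    show "\<Union>K \<subseteq> carrier (G Mod N)" using K by blast
    have "{x \<in> carrier G. N #>\<^bsub>G\<^esub> x \<in> \<Union>K} = (\<Union>A\<in>K. {x \<in> carrier G. N #>\<^bsub>G\<^esub> x \<in> A})" by blast
    then show "openin T {x \<in> carrier G. N #>\<^bsub>G\<^esub> x \<in> \<Union>K}"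
      using K by auto
  qed
  then show ?thesis
    by (simp add: quotient_topology_def)
qed

lemma quotient_map_quotient_topology:
  assumes "topspace T = carrier G"
  shows "quotient_map T (quotient_topology G T N) (\<lambda>x. N #>\<^bsub>G\<^esub> x)"
proof -
  have "openin (quotient_topology G T N) (carrier (G Mod N))"
  proof -
    have "{x \<in> carrier G. N #>\<^bsub>G\<^esub> x \<in> carrier (G Mod N)} = topspace T"
      using assms by (auto simp: carrier_FactGroup)
    then show ?thesis
      using openin_topspace[of T] by (simp add: openin_quotient_topology[OF assms])
  qed
  moreover have "topspace (quotient_topology G T N) \<subseteq> carrier (G Mod N)"
    using openin_topspace[of "quotient_topology G T N"] assms
    by (simp only: openin_quotient_topology)
  ultimately have "topspace (quotient_topology G T N) = carrier (G Mod N)"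
    by (meson openin_subset subset_antisym)
  then show ?thesis
    using assms unfolding quotient_map_def
    by (auto simp: openin_quotient_topology carrier_FactGroup)
qed

primrec topological_derived_series ::
    "('a, 'b) monoid_scheme \<Rightarrow> 'a topology \<Rightarrow> nat \<Rightarrow> 'a set" where
  "topological_derived_series G T 0 = carrier G"
| "topological_derived_series G T (Suc m) = T closure_of (derived G (topological_derived_series G T m))"

definition solvable_quotient :: "('a, 'b) monoid_scheme \<Rightarrow> 'a topology \<Rightarrow> nat \<Rightarrow> 'a set monoid" where
  "solvable_quotient G T m = G Mod (topological_derived_series G T m)"

definition solvable_quotient_topology ::
    "('a, 'b) monoid_scheme \<Rightarrow> 'a topology \<Rightarrow> nat \<Rightarrow> 'a set topology" where
  "solvable_quotient_topology G T m = quotient_topology G T (topological_derived_series G T m)"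

definition solvable_quotient_proj :: "('a, 'b) monoid_scheme \<Rightarrow> 'a topology \<Rightarrow> nat \<Rightarrow> 'a \<Rightarrow> 'a set" where
  "solvable_quotient_proj G T m x = topological_derived_series G T m #>\<^bsub>G\<^esub> x"

text \<open>The order \<open>r\<close> directs the index set \<open>I\<close>; for \<open>(i, j) \<in> r\<close> (that is, \<open>i\<close> below \<open>j\<close>) the
  transition map \<open>\<phi> i j\<close> goes from \<open>H j\<close> to \<open>H i\<close>.\<close>

definition inverse_system ::
    "'i set \<Rightarrow> ('i \<times> 'i) set \<Rightarrow> ('i \<Rightarrow> 'g monoid) \<Rightarrow> ('i \<Rightarrow> 'i \<Rightarrow> 'g \<Rightarrow> 'g) \<Rightarrow> bool" where
  "inverse_system I r H \<phi> \<longleftrightarrow>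
     I \<noteq> {} \<and> r \<subseteq> I \<times> I \<and> refl_on I r \<and> antisym r \<and> trans r \<and>
     (\<forall>i\<in>I. \<forall>j\<in>I. \<exists>k\<in>I. (i, k) \<in> r \<and> (j, k) \<in> r) \<and>
     (\<forall>i\<in>I. group (H i)) \<and>
     (\<forall>(i, j)\<in>r. \<phi> i j \<in> hom (H j) (H i)) \<and>
     (\<forall>i\<in>I. \<forall>x\<in>carrier (H i). \<phi> i i x = x) \<and>
     (\<forall>i j k. (i, j) \<in> r \<and> (j, k) \<in> r \<longrightarrow> (\<forall>x\<in>carrier (H k). \<phi> i j (\<phi> j k x) = \<phi> i k x))"

definition inverse_limit ::
    "'i set \<Rightarrow> ('i \<times> 'i) set \<Rightarrow> ('i \<Rightarrow> 'g monoid) \<Rightarrow> ('i \<Rightarrow> 'i \<Rightarrow> 'g \<Rightarrow> 'g) \<Rightarrow> ('i \<Rightarrow> 'g) monoid" where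
  "inverse_limit I r H \<phi> =
     (product_group I H)
       \<lparr>carrier := {x \<in> carrier (product_group I H). \<forall>(i, j)\<in>r. \<phi> i j (x j) = x i}\<rparr>"

text \<open>The groups of the system carry the discrete topology.\<close>

definition inverse_limit_topology ::
    "'i set \<Rightarrow> ('i \<times> 'i) set \<Rightarrow> ('i \<Rightarrow> 'g monoid) \<Rightarrow> ('i \<Rightarrow> 'i \<Rightarrow> 'g \<Rightarrow> 'g) \<Rightarrow> ('i \<Rightarrow> 'g) topology" where
  "inverse_limit_topology I r H \<phi> =
     subtopology (product_topology (\<lambda>i. discrete_topology (carrier (H i))) I)
       (carrier (inverse_limit I r H \<phi>))"

definition finite_sigma_group :: "nat set \<Rightarrow> ('a, 'b) monoid_scheme \<Rightarrow> bool" where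
  "finite_sigma_group \<Sigma> G \<longleftrightarrow>
     group G \<and> finite (carrier G) \<and> (\<forall>p. Factorial_Ring.prime p \<and> p dvd card (carrier G) \<longrightarrow> p \<in> \<Sigma>)"

text \<open>The types of the index set and of the finite groups are no restriction: every finite group
  has a copy with carrier in \<^typ>\<open>nat\<close>, and a group which is an inverse limit over any directed set
  is also the inverse limit of its quotients by open normal subgroups, which are indexed by
  subsets of the carrier.\<close>

definition pro_sigma_group :: "nat set \<Rightarrow> 'a monoid \<Rightarrow> 'a topology \<Rightarrow> bool" where
  "pro_sigma_group \<Sigma> G T \<longleftrightarrow>
     topological_group G T \<and>
     (\<exists>(I :: 'a set set) r (H :: 'a set \<Rightarrow> nat monoid) \<phi>.
        inverse_system I r H \<phi> \<and> (\<forall>i\<in>I. finite_sigma_group \<Sigma> (H i)) \<and>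
        topologically_isomorphic G T (inverse_limit I r H \<phi>) (inverse_limit_topology I r H \<phi>))"

definition converges_to_one :: "('a, 'b) monoid_scheme \<Rightarrow> 'a topology \<Rightarrow> ('x \<Rightarrow> 'a) \<Rightarrow> 'x set \<Rightarrow> bool" where
  "converges_to_one G T \<phi> X \<longleftrightarrow>
     (\<forall>U. subgroup U G \<and> openin T U \<longrightarrow> finite {x \<in> X. \<phi> x \<notin> U})"

text \<open>The universal property is required for the pro-\<open>\<Sigma>\<close> groups \<open>H\<close> with carrier in
  \<^typ>\<open>nat + 'a\<close>, since a definition cannot quantify over types. This implies it for all
  pro-\<open>\<Sigma>\<close> groups: every finite group has a copy with carrier in \<^typ>\<open>nat + 'a\<close>, and a pro-\<open>\<Sigma>\<close>
  group is the inverse limit of its finite quotients, to which the uniquely determined extensions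
  of the composites with \<open>\<phi>\<close> can be glued.\<close>

definition free_pro_sigma_group :: "nat set \<Rightarrow> 'a monoid \<Rightarrow> 'a topology \<Rightarrow> 'a set \<Rightarrow> bool" where
  "free_pro_sigma_group \<Sigma> F T X \<longleftrightarrow>
     pro_sigma_group \<Sigma> F T \<and> X \<subseteq> carrier F \<and>
     converges_to_one F T (\<lambda>x. x) X \<and>
     topologically_generated F T X = carrier F \<and>
     (\<forall>(H :: (nat + 'a) monoid) S \<phi>.
        pro_sigma_group \<Sigma> H S \<and> \<phi> \<in> X \<rightarrow> carrier H \<and> converges_to_one H S \<phi> X \<longrightarrow>
        (\<exists>!f. f \<in> topological_hom F T H S \<inter> extensional (carrier F) \<and> (\<forall>x\<in>X. f x = \<phi> x)))"

abbreviation nat_order :: "(nat \<times> nat) set" where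
  "nat_order \<equiv> {(i, j). i \<le> j}"

definition adic_integers :: "nat \<Rightarrow> (nat \<Rightarrow> int) monoid" where
  "adic_integers l =
     inverse_limit UNIV nat_order (\<lambda>k. integer_mod_group (l ^ k)) (\<lambda>i j a. a mod int (l ^ i))"

definition adic_topology :: "nat \<Rightarrow> (nat \<Rightarrow> int) topology" where
  "adic_topology l =
     inverse_limit_topology UNIV nat_order (\<lambda>k. integer_mod_group (l ^ k)) (\<lambda>i j a. a mod int (l ^ i))"

definition Z_sigma :: "nat set \<Rightarrow> (nat \<Rightarrow> nat \<Rightarrow> int) monoid" where
  "Z_sigma \<Sigma> = product_group \<Sigma> adic_integers"

definition Z_sigma_topology :: "nat set \<Rightarrow> (nat \<Rightarrow> nat \<Rightarrow> int) topology" where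
  "Z_sigma_topology \<Sigma> = product_topology adic_topology \<Sigma>"

lemma inverse_system_adic:
  assumes "l > 0"
  shows "inverse_system UNIV nat_order (\<lambda>k. integer_mod_group (l ^ k)) (\<lambda>i j a. a mod int (l ^ i))"
proof -
  have dvd: "int l ^ i dvd int l ^ j" if "i \<le> j" for i j
    using that by (rule le_imp_power_dvd)
  have "(\<lambda>a. a mod int (l ^ i)) \<in> hom (integer_mod_group (l ^ j)) (integer_mod_group (l ^ i))"
    if "i \<le> j" for i j
    using assms dvd[OF that]
    by (auto simp: hom_def carrier_integer_mod_group mod_mod_cancel mod_add_eq)
  moreover have "\<exists>k. i \<le> k \<and> j \<le> k" for i j :: nat
    by (intro exI[of _ "max i j"]) auto
  moreover have "a mod int (l ^ i) = a" if "a \<in> carrier (integer_mod_group (l ^ i))" for a i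
    using that assms by (auto simp: carrier_integer_mod_group)
  ultimately show ?thesis
    using assms dvd unfolding inverse_system_def
    by (auto simp: refl_on_def antisym_def trans_def mod_mod_cancel)
qed

end

theory Submission
  imports Defs "HOL-Algebra.Multiplicative_Group" "HOL-Number_Theory.Cong"
begin

text \<open>
  Everything is detected in finite \<open>\<Sigma>\<close>-quotients. Let \<open>g\<close> commute with \<open>x\<^sup>n\<close> modulo \<open>F\<^bsup>[m]\<^esup>\<close>.
  The universal property lifts a map \<open>F \<rightarrow> P\<close> that kills \<open>F\<^bsup>[m-1]\<^esup>\<close> to maps from \<open>F\<close> to wreath
  products \<open>A \<wr> P\<close> with \<open>A\<close> abelian and arbitrary \<open>A\<close>-components on \<open>X\<close>; these lifts kill \<open>F\<^bsup>[m]\<^esup>\<close>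
  and amount to cocycles \<open>b (g h) r = b g r + b h (r g)\<close>.

  First take \<open>A = \<int>/p\<^sup>n\<close>, with the delta function at \<open>1\<close> on \<open>x\<close> and \<open>0\<close> on the other generators. Summing
  the commutation relation over the subgroup of \<open>P\<close> generated by \<open>x\<close> gives \<open>n = 0\<close> in \<open>A\<close> unless the
  image of \<open>g\<close> in \<open>P\<close> is a power of \<open>x\<close>.

  Now let \<open>F \<rightarrow> Q\<close> kill \<open>F\<^bsup>[m]\<^esup>\<close>, let \<open>A\<close> be the image of \<open>F\<^bsup>[m-1]\<^esup>\<close> in \<open>Q\<close>, let \<open>P = Q/A\<close>, and let
  \<open>P' = P \<times> \<int>/M\<close> with \<open>x\<close> mapped to \<open>1\<close> in \<open>\<int>/M\<close>. After multiplying \<open>g\<close> by a power of \<open>x\<close> it dies in \<open>P'\<close>.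
  The Kaloujnine--Krasner cocycle of \<open>Q\<close> is the sum over the fibres of \<open>P' \<rightarrow> P\<close> of a cocycle \<open>b\<close> on \<open>P'\<close>,
  and commutation makes \<open>b g\<close> invariant under translation by \<open>x\<^sup>n\<close>. For suitable \<open>M\<close> this makes
  the fibre sums multiples of the order of \<open>A\<close>, so \<open>g\<close> dies in \<open>Q\<close>.

  If \<open>X\<close> has two elements \<open>x \<noteq> y\<close>, an open subgroup contains \<open>x\<^sup>n\<close> and \<open>y\<^sup>n\<close> for some \<open>n > 0\<close>, so its
  centralizer lies in the closures of both \<open>\<langle>x\<rangle>\<close> and \<open>\<langle>y\<rangle>\<close>, whose intersection is trivial.
\<close>

section \<open>Finite groups as pro-\<open>\<Sigma>\<close> groups\<close>

text \<open>Copies a group along a map \<open>c\<close>, meant to be injective on the carrier. This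
  moves finite groups into the types prescribed by the definitions: \<open>nat\<close> for the
  groups of an inverse system, \<open>nat + 'a\<close> for the targets of the universal
  property.\<close>

definition transport_group :: "('a \<Rightarrow> 'b) \<Rightarrow> ('a, 'c) monoid_scheme \<Rightarrow> 'b monoid" where
  "transport_group c G =
     \<lparr>carrier = c ` carrier G,
      monoid.mult = (\<lambda>a b. c (inv_into (carrier G) c a \<otimes>\<^bsub>G\<^esub> inv_into (carrier G) c b)),
      one = c \<one>\<^bsub>G\<^esub>\<rparr>"

lemma carrier_transport_group [simp]: "carrier (transport_group c G) = c ` carrier G"
  by (simp add: transport_group_def)

lemma one_transport_group [simp]: "\<one>\<^bsub>transport_group c G\<^esub> = c \<one>\<^bsub>G\<^esub>"
  by (simp add: transport_group_def)

lemma mult_transport_group [simp]: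
  assumes "inj_on c (carrier G)" "a \<in> carrier G" "b \<in> carrier G"
  shows "c a \<otimes>\<^bsub>transport_group c G\<^esub> c b = c (a \<otimes>\<^bsub>G\<^esub> b)"
  using assms by (simp add: transport_group_def)

lemma group_transport_group:
  assumes "group G" "inj_on c (carrier G)"
  shows "group (transport_group c G)"
proof -
  interpret group G by fact
  show ?thesis
  proof (rule groupI)
    fix x assume "x \<in> carrier (transport_group c G)"
    then obtain a where a: "a \<in> carrier G" "x = c a" by auto
    then show "\<exists>y\<in>carrier (transport_group c G). y \<otimes>\<^bsub>transport_group c G\<^esub> x = \<one>\<^bsub>transport_group c G\<^esub>"
      using assms(2) by (intro bexI[of _ "c (inv\<^bsub>G\<^esub> a)"]) (auto simp: group.l_inv[OF assms(1)])
  qed (use assms(2) in \<open>auto simp: m_assoc\<close>)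
qed

lemma finite_sigma_group_transport_group:
  assumes "finite_sigma_group \<Sigma> G" "inj_on c (carrier G)"
  shows "finite_sigma_group \<Sigma> (transport_group c G)"
  using assms by (auto simp: finite_sigma_group_def group_transport_group card_image)

lemma finite_imp_inj_nat: "finite A \<Longrightarrow> \<exists>c :: 'a \<Rightarrow> nat. inj_on c A"
  using finite_imp_inj_to_nat_seg by metis

text \<open>A finite group is the inverse limit of the constant system over a one-point index set,
  formed with a copy of the group in \<open>nat\<close>.\<close>

lemma pro_sigma_group_discrete:
  fixes H :: "'b monoid"
  assumes "finite_sigma_group \<Sigma> H"
  shows "pro_sigma_group \<Sigma> H (discrete_topology (carrier H))"
proof -
  have H: "group H" and fin: "finite (carrier H)"
    using assms by (auto simp: finite_sigma_group_def)
  interpret group H by fact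
  obtain c :: "'b \<Rightarrow> nat" where c: "inj_on c (carrier H)"
    using finite_imp_inj_nat[OF fin] by blast
  have tg: "topological_group H (discrete_topology (carrier H))"
    unfolding topological_group_def
    by (auto simp: H prod_topology_discrete_topology[symmetric])
  let ?I = "{{}} :: 'b set set" and ?r = "{({}, {})} :: ('b set \<times> 'b set) set"
    and ?K = "\<lambda>_ :: 'b set. transport_group c H" and ?p = "\<lambda>_ _ :: 'b set. \<lambda>x :: nat. x"
  let ?L = "inverse_limit ?I ?r ?K ?p" and ?TL = "inverse_limit_topology ?I ?r ?K ?p"
  have sys: "inverse_system ?I ?r ?K ?p"
    by (auto simp: inverse_system_def refl_on_def antisym_def trans_def hom_def
        group_transport_group[OF H c] c)
  have carL: "carrier ?L = (\<Pi>\<^sub>E i\<in>?I. c ` carrier H)"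
    by (auto simp: inverse_limit_def)
  let ?f = "\<lambda>h. \<lambda>i\<in>?I. c h"
  have bij: "bij_betw ?f (carrier H) (carrier ?L)"
    unfolding bij_betw_def
  proof
    show "inj_on ?f (carrier H)"
      using c by (auto simp: inj_on_def fun_eq_iff)
    show "?f ` carrier H = carrier ?L"
      unfolding carL
    proof
      show "(\<Pi>\<^sub>E i\<in>?I. c ` carrier H) \<subseteq> ?f ` carrier H"
      proof
        fix u assume u: "u \<in> (\<Pi>\<^sub>E i\<in>?I. c ` carrier H)"
        then obtain h where "h \<in> carrier H" "u {} = c h"
          by (auto simp: PiE_iff)
        then have "u = ?f h"
          using u by (auto simp: fun_eq_iff PiE_iff extensional_def)
        then show "u \<in> ?f ` carrier H"
          using \<open>h \<in> carrier H\<close> by blast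
      qed
    qed (simp add: image_subset_iff)
  qed
  have iso: "?f \<in> iso H ?L"
    using bij by (auto simp: iso_def hom_def carL inverse_limit_def c bij_betw_def fun_eq_iff)
  have top: "topspace ?TL = carrier ?L"
    unfolding inverse_limit_topology_def by (auto simp: carL)
  \<comment> \<open>A continuous bijection from a compact space to a Hausdorff space is a
    homeomorphism.\<close>
  have "homeomorphic_map (discrete_topology (carrier H)) ?TL ?f"
  proof (rule continuous_imp_homeomorphic_map)
    show "continuous_map (discrete_topology (carrier H)) ?TL ?f"
      using bij by (auto simp: top bij_betw_def)
    show "compact_space (discrete_topology (carrier H))"
      by (simp add: compact_space_discrete_topology fin)
    show "Hausdorff_space ?TL"
      unfolding inverse_limit_topology_def
      by (intro Hausdorff_space_subtopology) (simp add: Hausdorff_space_product_topology)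
  qed (use bij in \<open>auto simp: top bij_betw_def\<close>)
  then have "topologically_isomorphic H (discrete_topology (carrier H)) ?L ?TL"
    using iso unfolding topologically_isomorphic_def by blast
  moreover have "finite_sigma_group \<Sigma> (transport_group c H)"
    using finite_sigma_group_transport_group[OF assms c] .
  ultimately show ?thesis
    unfolding pro_sigma_group_def using tg sys
    by (intro conjI exI[of _ ?I] exI[of _ ?r] exI[of _ ?K] exI[of _ ?p]) simp_all
qed

section \<open>Continuous homomorphisms to finite \<open>\<Sigma>\<close>-groups\<close>

text \<open>Continuity for the discrete topology, with no codomain fixed: values may be pairs or
  functions, and following \<open>f\<close> by an arbitrary map preserves the property.\<close>

definition locally_constant :: "'a topology \<Rightarrow> ('a \<Rightarrow> 'b) \<Rightarrow> bool" where
  "locally_constant T f \<longleftrightarrow> (\<forall>S. openin T {x \<in> topspace T. f x \<in> S})"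

lemma locally_constantD: "locally_constant T f \<Longrightarrow> openin T {x \<in> topspace T. f x \<in> S}"
  by (simp add: locally_constant_def)

lemma locally_constantI:
  assumes "\<And>y. openin T {x \<in> topspace T. f x = y}"
  shows "locally_constant T f"
  unfolding locally_constant_def
proof
  fix S
  have "{x \<in> topspace T. f x \<in> S} = (\<Union>y\<in>S. {x \<in> topspace T. f x = y})" by auto
  then show "openin T {x \<in> topspace T. f x \<in> S}"
    using assms by auto
qed

lemma locally_constant_pair:
  assumes "locally_constant T f" "locally_constant T g"
  shows "locally_constant T (\<lambda>x. (f x, g x))"
proof (rule locally_constantI)
  fix y
  have "{x \<in> topspace T. (f x, g x) = y} =
      {x \<in> topspace T. f x \<in> {fst y}} \<inter> {x \<in> topspace T. g x \<in> {snd y}}"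
    by auto
  then show "openin T {x \<in> topspace T. (f x, g x) = y}"
    using openin_Int[OF locally_constantD[OF assms(1), of "{fst y}"] locally_constantD[OF assms(2), of "{snd y}"]]
    by simp
qed

lemma locally_constant_compose:
  assumes "locally_constant T f"
  shows "locally_constant T (\<lambda>x. g (f x))"
  unfolding locally_constant_def
proof
  fix S
  show "openin T {x \<in> topspace T. g (f x) \<in> S}"
    using locally_constantD[OF assms, of "{y. g y \<in> S}"] by simp
qed

lemma locally_constant_cong:
  assumes "locally_constant T f" "\<And>x. x \<in> topspace T \<Longrightarrow> f x = g x"
  shows "locally_constant T g"
proof -
  have "{x \<in> topspace T. g x \<in> S} = {x \<in> topspace T. f x \<in> S}" for S
    using assms(2) by auto
  with assms(1) show ?thesis
    by (simp add: locally_constant_def)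
qed

lemma locally_constant_closedin:
  assumes "locally_constant T f"
  shows "closedin T {x \<in> topspace T. f x \<in> S}"
proof -
  have "topspace T - {x \<in> topspace T. f x \<in> S} = {x \<in> topspace T. f x \<in> - S}" by auto
  then show ?thesis
    using locally_constantD[OF assms, of "- S"] by (auto simp: closedin_def)
qed

lemma locally_constant_if_continuous:
  "continuous_map T (discrete_topology A) f \<Longrightarrow> locally_constant T f"
proof (rule locally_constantI)
  fix y assume f: "continuous_map T (discrete_topology A) f"
  then have "openin T {x \<in> topspace T. f x \<in> {y} \<inter> A}"
    by (intro openin_continuous_map_preimage) auto
  moreover have "{x \<in> topspace T. f x \<in> {y} \<inter> A} = {x \<in> topspace T. f x = y}"
    using f by (auto simp: continuous_map_def)
  ultimately show "openin T {x \<in> topspace T. f x = y}"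
    by simp
qed

text \<open>The actual quotient of \<open>F\<close> is the image of \<open>f\<close>, a subgroup of
  \<open>Q\<close>. This lets maps be paired and extended without computing images.\<close>

definition finite_quotient_map ::
    "nat set \<Rightarrow> ('a, 'c) monoid_scheme \<Rightarrow> 'a topology \<Rightarrow> ('b, 'd) monoid_scheme \<Rightarrow> ('a \<Rightarrow> 'b) \<Rightarrow> bool" where
  "finite_quotient_map \<Sigma> F T Q f \<longleftrightarrow>
     finite_sigma_group \<Sigma> Q \<and> f \<in> hom F Q \<and> locally_constant T f"

lemma finite_sigma_group_integer_mod_group:
  assumes "n > 0" "\<And>p. Factorial_Ring.prime p \<Longrightarrow> p dvd n \<Longrightarrow> p \<in> \<Sigma>"
  shows "finite_sigma_group \<Sigma> (integer_mod_group n)"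
  using assms by (auto simp: finite_sigma_group_def carrier_integer_mod_group)

lemma finite_sigma_group_DirProd:
  assumes "finite_sigma_group \<Sigma> G" "finite_sigma_group \<Sigma> H"
  shows "finite_sigma_group \<Sigma> (G \<times>\<times> H)"
  using assms by (auto simp: finite_sigma_group_def DirProd_group card_cartesian_product prime_dvd_mult_iff)

lemma finite_quotient_map_pair:
  assumes "finite_quotient_map \<Sigma> F T Q f" "finite_quotient_map \<Sigma> F T R g"
  shows "finite_quotient_map \<Sigma> F T (Q \<times>\<times> R) (\<lambda>x. (f x, g x))"
  using assms unfolding finite_quotient_map_def
  by (auto simp: finite_sigma_group_DirProd locally_constant_pair hom_def Pi_iff)

section \<open>Pro-\<open>\<Sigma>\<close> groups\<close>

lemma (in group) r_coset_eq_iff: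
  assumes "subgroup N G" "u \<in> carrier G" "v \<in> carrier G"
  shows "N #> u = N #> v \<longleftrightarrow> u \<otimes> inv v \<in> N"
proof -
  have "N #> u = N #> v \<longleftrightarrow> u \<in> N #> v"
    using assms repr_independence rcos_self by metis
  then show ?thesis
    using subgroup.rcos_module[OF assms(1) is_group assms(3,2)] by simp
qed

lemma (in group) r_coset_eq_self_iff:
  assumes "subgroup N G" "g \<in> carrier G"
  shows "N #> g = N \<longleftrightarrow> g \<in> N"
  using assms coset_join1 coset_join2 subgroup.subset by metis

text \<open>The image is isomorphic to the group modulo the kernel, so Lagrange's theorem
  applies.\<close>

lemma card_hom_image_dvd:
  assumes "group G" "group H" "h \<in> hom G H" "finite (carrier G)"
  shows "card (h ` carrier G) dvd card (carrier G)"
proof -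
  interpret group_hom G H h
    using assms by (simp add: group_hom_def group_hom_axioms_def)
  let ?H = "H\<lparr>carrier := h ` carrier G\<rparr>"
  interpret i: group_hom G ?H h
    using assms img_is_subgroup
    by (simp add: group_hom_def group_hom_axioms_def subgroup.subgroup_is_group hom_def Pi_iff)
  have "(\<lambda>X. the_elem (h ` X)) \<in> iso (G Mod kernel G ?H h) ?H"
    using i.FactGroup_iso_set by simp
  then have "card (rcosets\<^bsub>G\<^esub> kernel G ?H h) = card (h ` carrier G)"
    using iso_same_card[OF is_isoI] by (fastforce simp: FactGroup_def)
  then show ?thesis
    using G.lagrange[OF i.subgroup_kernel] unfolding Coset.order_def by (metis dvd_triv_left)
qed

lemma finite_sigma_group_image:
  assumes "finite_sigma_group \<Sigma> G" "group H" "h \<in> hom G H" "h ` carrier G = carrier H"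
  shows "finite_sigma_group \<Sigma> H"
  using assms card_hom_image_dvd[of G H h] unfolding finite_sigma_group_def
  by (metis dvd_trans finite_imageI)

lemma finite_sigma_group_subgroup:
  assumes "finite_sigma_group \<Sigma> G" "subgroup K G"
  shows "finite_sigma_group \<Sigma> (G\<lparr>carrier := K\<rparr>)"
proof -
  interpret group G using assms by (simp add: finite_sigma_group_def)
  have "card K dvd card (carrier G)"
    using lagrange[OF assms(2)] unfolding Coset.order_def by (metis dvd_triv_right)
  moreover have "finite K"
    using assms subgroup.subset finite_subset unfolding finite_sigma_group_def by metis
  ultimately show ?thesis
    using assms by (auto simp: finite_sigma_group_def subgroup.subgroup_is_group intro: dvd_trans)
qed

text \<open>Each compatibility condition equates two continuous maps into a discrete, hence
  Hausdorff, space; the limit is the intersection of these closed sets.\<close>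

lemma inverse_limit_closedin:
  assumes "inverse_system I r H \<phi>"
  shows "closedin (product_topology (\<lambda>i. discrete_topology (carrier (H i))) I)
           (carrier (inverse_limit I r H \<phi>))"
proof -
  let ?P = "product_topology (\<lambda>i. discrete_topology (carrier (H i))) I"
  have r: "r \<noteq> {}" "r \<subseteq> I \<times> I" and hom: "\<And>i j. (i, j) \<in> r \<Longrightarrow> \<phi> i j \<in> hom (H j) (H i)"
    using assms by (auto simp: inverse_system_def refl_on_def)
  have "closedin ?P {x \<in> topspace ?P. \<phi> i j (x j) = x i}" if "(i, j) \<in> r" for i j
  proof (rule closedin_continuous_maps_eq)
    have ij: "i \<in> I" "j \<in> I" using r that by auto
    show "continuous_map ?P (discrete_topology (carrier (H i))) (\<lambda>x. x i)"
      using ij by (intro continuous_map_product_projection)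
    have "continuous_map ?P (discrete_topology (carrier (H i))) (\<phi> i j \<circ> (\<lambda>x. x j))"
      by (rule continuous_map_compose[OF continuous_map_product_projection[OF ij(2)]])
        (use hom[OF that] in \<open>auto simp: hom_def\<close>)
    then show "continuous_map ?P (discrete_topology (carrier (H i))) (\<lambda>x. \<phi> i j (x j))"
      by (simp add: comp_def)
  qed simp
  then have "closedin ?P (\<Inter>p\<in>r. {x \<in> topspace ?P. \<phi> (fst p) (snd p) (x (snd p)) = x (fst p)})"
    using r by (intro closedin_Inter) auto
  moreover have "carrier (inverse_limit I r H \<phi>) =
      (\<Inter>p\<in>r. {x \<in> topspace ?P. \<phi> (fst p) (snd p) (x (snd p)) = x (fst p)})"
  proof -
    have "carrier (inverse_limit I r H \<phi>) =
        {x \<in> topspace ?P. \<forall>p\<in>r. \<phi> (fst p) (snd p) (x (snd p)) = x (fst p)}"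
      by (simp add: inverse_limit_def case_prod_beta)
    then show ?thesis using r(1) by blast
  qed
  ultimately show ?thesis by simp
qed

lemma inverse_system_upper_bound:
  assumes "inverse_system I r H \<phi>" "finite J" "J \<subseteq> I"
  obtains k where "k \<in> I" "\<And>j. j \<in> J \<Longrightarrow> (j, k) \<in> r"
proof -
  have I: "I \<noteq> {}" and dir: "\<And>i j. i \<in> I \<Longrightarrow> j \<in> I \<Longrightarrow> \<exists>k\<in>I. (i, k) \<in> r \<and> (j, k) \<in> r"
    and tr: "trans r"
    using assms(1) unfolding inverse_system_def by auto
  have "\<exists>k\<in>I. \<forall>j\<in>J. (j, k) \<in> r"
    using assms(2,3)
  proof (induction rule: finite_induct)
    case empty
    then show ?case using I by auto
  next
    case (insert j J)
    then obtain k where k: "k \<in> I" "\<forall>j\<in>J. (j, k) \<in> r" by auto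
    then obtain l where "l \<in> I" "(j, l) \<in> r" "(k, l) \<in> r"
      using dir insert.prems by (metis insert_subset)
    then show ?case
      using k tr by (metis insert_iff transD)
  qed
  then show ?thesis using that by blast
qed

section \<open>Topology of pro-\<Sigma> groups through finite quotients\<close>

locale pro_sigma =
  fixes \<Sigma> :: "nat set" and F :: "'a monoid" (structure) and T :: "'a topology"
  assumes pro_sigma: "pro_sigma_group \<Sigma> F T"

sublocale pro_sigma \<subseteq> group F
  using pro_sigma by (simp add: pro_sigma_group_def topological_group_def)

context pro_sigma
begin

lemma topspace_eq [simp]: "topspace T = carrier F"
  using pro_sigma by (simp add: pro_sigma_group_def topological_group_def)

lemma inverse_limit_presentation:
  obtains I r and H :: "'a set \<Rightarrow> nat monoid" and \<phi> \<theta> where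
    "inverse_system I r H \<phi>" "\<And>i. i \<in> I \<Longrightarrow> finite_sigma_group \<Sigma> (H i)"
    "\<theta> \<in> iso F (inverse_limit I r H \<phi>)"
    "homeomorphic_map T (inverse_limit_topology I r H \<phi>) \<theta>"
  using pro_sigma unfolding pro_sigma_group_def topologically_isomorphic_def by blast

text \<open>Transported from the inverse limit, a closed subspace of a product of finite discrete
  spaces.\<close>

lemma compact_Hausdorff: "compact_space T" "Hausdorff_space T"
proof -
  obtain I r H \<phi> \<theta> where sys: "inverse_system I r (H :: 'a set \<Rightarrow> nat monoid) \<phi>"
    and fin: "\<And>i. i \<in> I \<Longrightarrow> finite_sigma_group \<Sigma> (H i)"
    and \<theta>: "homeomorphic_map T (inverse_limit_topology I r H \<phi>) \<theta>"
    by (rule inverse_limit_presentation) blast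
  let ?P = "product_topology (\<lambda>i. discrete_topology (carrier (H i))) I"
  have h: "T homeomorphic_space (inverse_limit_topology I r H \<phi>)"
    using \<theta> homeomorphic_map_imp_homeomorphic_space by blast
  have "compact_space ?P"
    using fin by (auto simp: compact_space_product_topology compact_space_discrete_topology finite_sigma_group_def)
  then have "compactin ?P (carrier (inverse_limit I r H \<phi>))"
    using inverse_limit_closedin[OF sys] closedin_compact_space by blast
  then have "compact_space (inverse_limit_topology I r H \<phi>)"
    by (simp add: inverse_limit_topology_def compact_space_subtopology)
  then show "compact_space T"
    using homeomorphic_compact_space[OF h] by simp
  have "Hausdorff_space (inverse_limit_topology I r H \<phi>)"
    unfolding inverse_limit_topology_def
    by (intro Hausdorff_space_subtopology) (simp add: Hausdorff_space_product_topology)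
  then show "Hausdorff_space T"
    using homeomorphic_Hausdorff_space[OF h] by simp
qed

text \<open>A basic open set of the product restricts only finitely many coordinates. An index above
  all of them determines these coordinates through the transition maps, so that single coordinate
  serves as \<open>\<pi>\<close>.\<close>

lemma neighbourhood_contains_fibre:
  assumes W: "openin T W" and g: "g \<in> W"
  obtains Q :: "nat monoid" and \<pi> where "finite_quotient_map \<Sigma> F T Q \<pi>"
    "\<And>u. u \<in> carrier F \<Longrightarrow> \<pi> u = \<pi> g \<Longrightarrow> u \<in> W"
proof -
  obtain I r H \<phi> \<theta> where sys: "inverse_system I r (H :: 'a set \<Rightarrow> nat monoid) \<phi>"
    and fin: "\<And>i. i \<in> I \<Longrightarrow> finite_sigma_group \<Sigma> (H i)"
    and iso: "\<theta> \<in> iso F (inverse_limit I r H \<phi>)"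
    and homeo: "homeomorphic_map T (inverse_limit_topology I r H \<phi>) \<theta>"
    by (rule inverse_limit_presentation) blast
  let ?P = "product_topology (\<lambda>i. discrete_topology (carrier (H i))) I"
  let ?L = "inverse_limit I r H \<phi>" and ?TL = "inverse_limit_topology I r H \<phi>"
  have gF: "g \<in> carrier F"
    using W g openin_subset by fastforce
  have bij: "bij_betw \<theta> (carrier F) (carrier ?L)" and \<theta>hom: "\<theta> \<in> hom F ?L"
    using iso by (auto simp: iso_def)
  have WF: "W \<subseteq> carrier F"
    using W openin_subset by fastforce
  have "openin ?TL (\<theta> ` W)"
    using homeomorphic_imp_open_map[OF homeo] W by (simp add: open_map_def)
  then obtain V where V: "openin ?P V" "\<theta> ` W = V \<inter> carrier ?L"
    by (auto simp: inverse_limit_topology_def openin_subtopology)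
  then have "\<theta> g \<in> V" using g by auto
  then obtain U where U: "finite {i \<in> I. U i \<noteq> topspace (discrete_topology (carrier (H i)))}"
    "\<theta> g \<in> Pi\<^sub>E I U" "Pi\<^sub>E I U \<subseteq> V"
    using V(1) unfolding openin_product_topology_alt by meson
  then obtain k where k: "k \<in> I"
    "\<And>j. j \<in> {i \<in> I. U i \<noteq> topspace (discrete_topology (carrier (H i)))} \<Longrightarrow> (j, k) \<in> r"
    using inverse_system_upper_bound[OF sys U(1)] by auto
  have proj: "\<theta> u \<in> (\<Pi>\<^sub>E i\<in>I. carrier (H i))" "\<And>i j. (i, j) \<in> r \<Longrightarrow> \<phi> i j (\<theta> u j) = \<theta> u i"
    if "u \<in> carrier F" for u
    using bij that unfolding bij_betw_def inverse_limit_def by auto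
  show thesis
  proof
    have "continuous_map T ?TL \<theta>"
      using homeo homeomorphic_imp_continuous_map by blast
    then have "continuous_map T ?P \<theta>"
      by (simp add: inverse_limit_topology_def continuous_map_in_subtopology)
    then have "continuous_map T (discrete_topology (carrier (H k))) ((\<lambda>x. x k) \<circ> \<theta>)"
      using continuous_map_compose continuous_map_product_projection[OF k(1)] by blast
    then have "locally_constant T (\<lambda>u. \<theta> u k)"
      using locally_constant_if_continuous by (auto simp: comp_def)
    moreover have "(\<lambda>u. \<theta> u k) \<in> hom F (H k)"
      using \<theta>hom proj(1) k(1) by (auto simp: hom_def inverse_limit_def PiE_iff)
    ultimately show "finite_quotient_map \<Sigma> F T (H k) (\<lambda>u. \<theta> u k)"
      using fin[OF k(1)] by (simp add: finite_quotient_map_def)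
    fix u assume u: "u \<in> carrier F" "\<theta> u k = \<theta> g k"
    have "\<theta> u i \<in> U i" if "i \<in> I" for i
    proof (cases "U i = carrier (H i)")
      case True
      then show ?thesis using proj(1)[OF u(1)] that by auto
    next
      case False
      then have "(i, k) \<in> r" using k(2) that by auto
      then have "\<theta> u i = \<theta> g i"
        using proj(2)[OF u(1)] proj(2)[OF gF] u(2) by metis
      then show ?thesis using U(2) that by auto
    qed
    then have "\<theta> u \<in> Pi\<^sub>E I U"
      using proj(1)[OF u(1)] by (auto simp: PiE_iff)
    moreover have "\<theta> u \<in> carrier ?L"
      using bij u(1) by (auto simp: bij_betw_def)
    ultimately have "\<theta> u \<in> \<theta> ` W"
      using U(3) V(2) by auto
    then show "u \<in> W"
      using bij u(1) WF unfolding bij_betw_def by (auto dest: inj_onD)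
  qed
qed

lemma locally_constantD': "locally_constant T f \<Longrightarrow> openin T {x \<in> carrier F. f x \<in> S}"
  using locally_constantD[of T f S] by simp

text \<open>The fibre of \<open>f\<close> through \<open>g\<close> is an open neighbourhood of
  \<open>g\<close>, hence meets \<open>S\<close>.\<close>

lemma image_closure_of_subset:
  assumes "locally_constant T f" "g \<in> T closure_of S"
  shows "f g \<in> f ` S"
proof -
  have "openin T {x \<in> carrier F. f x \<in> {f g}}"
    using assms(1) by (rule locally_constantD')
  moreover have "g \<in> carrier F"
    using assms(2) by (simp add: in_closure_of)
  moreover have "\<forall>V. g \<in> V \<and> openin T V \<longrightarrow> (\<exists>y. y \<in> S \<and> y \<in> V)"
    using assms(2) by (simp add: in_closure_of)
  ultimately obtain y where "y \<in> S" "f y = f g"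
    by (auto dest!: spec[of _ "{x \<in> carrier F. f x \<in> {f g}}"])
  then show ?thesis by (metis imageI)
qed

text \<open>Makes closures algebraic: that the closure of a subgroup or of a normal subgroup is of
  the same kind can then be checked in finite quotients.\<close>

lemma in_closure_iff:
  assumes "S \<subseteq> carrier F"
  shows "g \<in> T closure_of S \<longleftrightarrow> g \<in> carrier F \<and>
    (\<forall>(Q :: nat monoid) \<pi>. finite_quotient_map \<Sigma> F T Q \<pi> \<longrightarrow> \<pi> g \<in> \<pi> ` S)"
proof
  assume "g \<in> T closure_of S"
  then show "g \<in> carrier F \<and>
    (\<forall>(Q :: nat monoid) \<pi>. finite_quotient_map \<Sigma> F T Q \<pi> \<longrightarrow> \<pi> g \<in> \<pi> ` S)"
    using image_closure_of_subset by (auto simp: in_closure_of finite_quotient_map_def)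
next
  assume *: "g \<in> carrier F \<and>
    (\<forall>(Q :: nat monoid) \<pi>. finite_quotient_map \<Sigma> F T Q \<pi> \<longrightarrow> \<pi> g \<in> \<pi> ` S)"
  show "g \<in> T closure_of S"
    unfolding in_closure_of
  proof (intro conjI allI impI)
    fix W assume "g \<in> W \<and> openin T W"
    then obtain Q :: "nat monoid" and \<pi> where Q: "finite_quotient_map \<Sigma> F T Q \<pi>"
      "\<And>u. u \<in> carrier F \<Longrightarrow> \<pi> u = \<pi> g \<Longrightarrow> u \<in> W"
      using neighbourhood_contains_fibre by blast
    then obtain s where "s \<in> S" "\<pi> s = \<pi> g"
      using * by (metis imageE)
    then show "\<exists>y. y \<in> S \<and> y \<in> W"
      using Q(2) assms by blast
  qed (use * in simp)
qed

lemma group_hom_finite_quotient_map: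
  "finite_quotient_map \<Sigma> F T Q f \<Longrightarrow> group_hom F Q f"
  by (simp add: finite_quotient_map_def finite_sigma_group_def group_hom_def group_hom_axioms_def
      group_axioms)

lemma subgroup_closure_of:
  assumes "subgroup S F"
  shows "subgroup (T closure_of S) F"
proof -
  interpret S: subgroup S F by fact
  have img: "subgroup (\<pi> ` S) Q" "group_hom F Q \<pi>" if "finite_quotient_map \<Sigma> F T Q \<pi>"
    for Q :: "nat monoid" and \<pi>
    using group_hom_finite_quotient_map[OF that] assms group_hom.subgroup_img_is_subgroup by blast+
  show ?thesis
  proof (rule subgroupI)
    show "T closure_of S \<subseteq> carrier F"
      using closure_of_subset_topspace by fastforce
    have "S \<subseteq> T closure_of S"
      using closure_of_subset[of S T] S.subset by simp
    then show "T closure_of S \<noteq> {}"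
      using S.one_closed by blast
  next
    fix a assume a: "a \<in> T closure_of S"
    show "inv a \<in> T closure_of S"
      unfolding in_closure_iff[OF S.subset]
    proof (intro conjI allI impI)
      show "inv a \<in> carrier F"
        using a by (simp add: in_closure_iff[OF S.subset])
      fix Q :: "nat monoid" and \<pi> assume Q: "finite_quotient_map \<Sigma> F T Q \<pi>"
      then have "\<pi> a \<in> \<pi> ` S" "a \<in> carrier F"
        using a by (simp_all add: in_closure_iff[OF S.subset])
      then show "\<pi> (inv a) \<in> \<pi> ` S"
        using img[OF Q] by (simp add: group_hom.hom_inv subgroup.m_inv_closed)
    qed
  next
    fix a b assume a: "a \<in> T closure_of S" and b: "b \<in> T closure_of S"
    show "a \<otimes> b \<in> T closure_of S"
      unfolding in_closure_iff[OF S.subset]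
    proof (intro conjI allI impI)
      show "a \<otimes> b \<in> carrier F"
        using a b by (simp add: in_closure_iff[OF S.subset])
      fix Q :: "nat monoid" and \<pi> assume Q: "finite_quotient_map \<Sigma> F T Q \<pi>"
      then have "\<pi> a \<in> \<pi> ` S" "a \<in> carrier F" "\<pi> b \<in> \<pi> ` S" "b \<in> carrier F"
        using a b by (simp_all add: in_closure_iff[OF S.subset])
      then show "\<pi> (a \<otimes> b) \<in> \<pi> ` S"
        using img[OF Q] by (simp add: group_hom.hom_mult subgroup.m_closed)
    qed
  qed
qed

lemma normal_closure_of:
  assumes "S \<lhd> F"
  shows "T closure_of S \<lhd> F"
  unfolding normal_inv_iff
proof (intro conjI ballI)
  have S: "subgroup S F" "S \<subseteq> carrier F"
    using assms normal_imp_subgroup subgroup.subset by blast+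
  show "subgroup (T closure_of S) F"
    using S by (intro subgroup_closure_of)
  fix x h assume x: "x \<in> carrier F" and h: "h \<in> T closure_of S"
  show "x \<otimes> h \<otimes> inv x \<in> T closure_of S"
    unfolding in_closure_iff[OF S(2)]
  proof (intro conjI allI impI)
    have hF: "h \<in> carrier F"
      using h by (simp add: in_closure_iff[OF S(2)])
    then show "x \<otimes> h \<otimes> inv x \<in> carrier F" using x by simp
    fix Q :: "nat monoid" and \<pi> assume Q: "finite_quotient_map \<Sigma> F T Q \<pi>"
    interpret \<pi>: group_hom F Q \<pi> using group_hom_finite_quotient_map[OF Q] .
    obtain s where s: "s \<in> S" "\<pi> s = \<pi> h"
      using h Q unfolding in_closure_iff[OF S(2)] by (metis imageE)
    have "x \<otimes> s \<otimes> inv x \<in> S"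
      by (rule normal.inv_op_closed2[OF assms x s(1)])
    moreover have "\<pi> (x \<otimes> s \<otimes> inv x) = \<pi> (x \<otimes> h \<otimes> inv x)"
      using x hF s S(2) by (simp add: subset_eq)
    ultimately show "\<pi> (x \<otimes> h \<otimes> inv x) \<in> \<pi> ` S" by (metis imageI)
  qed
qed

section \<open>The topological derived series and open normal subgroups\<close>

abbreviation D :: "nat \<Rightarrow> 'a set" where
  "D \<equiv> topological_derived_series F T"

lemma normal_D: "D k \<lhd> F"
proof (induction k)
  case 0
  then show ?case by (simp add: normal_self)
next
  case (Suc k)
  then show ?case by (simp add: normal_closure_of derived_is_normal)
qed

lemma subgroup_D: "subgroup (D k) F"
  using normal_D normal_imp_subgroup by blast

lemma D_subset: "D k \<subseteq> carrier F"
  using subgroup_D subgroup.subset by blast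

lemma closedin_D: "closedin T (D k)"
  by (cases k) (metis closedin_topspace topological_derived_series.simps(1) topspace_eq, simp)

lemma D_Suc_subset: "D (Suc k) \<subseteq> D k"
  by (simp add: closure_of_minimal closedin_D derived_incl[OF subset_refl subgroup_D])

lemma commutator_in_D_Suc:
  assumes "a \<in> D k" "b \<in> D k"
  shows "a \<otimes> b \<otimes> inv a \<otimes> inv b \<in> D (Suc k)"
proof -
  have "a \<otimes> b \<otimes> inv a \<otimes> inv b \<in> derived F (D k)"
    unfolding derived_def using assms by (intro generate.incl) auto
  moreover have "derived F (D k) \<subseteq> carrier F"
    by (simp add: D_subset derived_in_carrier)
  ultimately show ?thesis
    using closure_of_subset[of "derived F (D k)" T] by auto
qed

text \<open>\<open>f\<close> kills the commutators of \<open>D k\<close>, hence the subgroup they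
  generate, and local constancy carries this over to the closure.\<close>

lemma trivial_on_D_Suc:
  assumes Q: "finite_quotient_map \<Sigma> F T Q f"
    and comm: "\<And>a b. a \<in> D k \<Longrightarrow> b \<in> D k \<Longrightarrow> f a \<otimes>\<^bsub>Q\<^esub> f b = f b \<otimes>\<^bsub>Q\<^esub> f a"
    and d: "d \<in> D (Suc k)"
  shows "f d = \<one>\<^bsub>Q\<^esub>"
proof -
  interpret f: group_hom F Q f using group_hom_finite_quotient_map[OF Q] .
  have D: "a \<in> carrier F" if "a \<in> D k" for a
    using D_subset that by blast
  have "f (a \<otimes> b \<otimes> inv a \<otimes> inv b) = \<one>\<^bsub>Q\<^esub>" if "a \<in> D k" "b \<in> D k" for a b
    using comm[OF that] D[OF that(1)] D[OF that(2)]
    by (simp add: f.H.m_assoc f.H.inv_solve_right' flip: f.H.inv_mult_group)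
  then have "derived F (D k) \<subseteq> kernel F Q f"
    unfolding derived_def
    by (intro generate_subgroup_incl[OF _ f.subgroup_kernel] subsetI) (auto simp: kernel_def D)
  moreover have "f d \<in> f ` derived F (D k)"
    using image_closure_of_subset Q d by (auto simp: finite_quotient_map_def)
  ultimately show ?thesis
    by (auto simp: kernel_def)
qed

lemma normal_open_kernel:
  assumes "finite_quotient_map \<Sigma> F T Q f"
  shows "{g \<in> carrier F. f g = \<one>\<^bsub>Q\<^esub>} \<lhd> F" "openin T {g \<in> carrier F. f g = \<one>\<^bsub>Q\<^esub>}"
proof -
  interpret f: group_hom F Q f using group_hom_finite_quotient_map[OF assms] .
  show "{g \<in> carrier F. f g = \<one>\<^bsub>Q\<^esub>} \<lhd> F"
    using f.normal_kernel by (simp add: kernel_def)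
  show "openin T {g \<in> carrier F. f g = \<one>\<^bsub>Q\<^esub>}"
    using assms locally_constantD'[of f "{\<one>\<^bsub>Q\<^esub>}"] by (simp add: finite_quotient_map_def)
qed

text \<open>An open \<open>N\<close> contains the kernel of some map \<open>\<pi>\<close> to a
  finite \<Sigma>-group, so the coset map factors through the image of \<open>\<pi>\<close>.
  Finiteness, the condition on the order and local constancy all follow.\<close>

lemma finite_quotient_map_Mod:
  assumes N: "N \<lhd> F" and op: "openin T N"
  shows "finite_quotient_map \<Sigma> F T (F Mod N) (\<lambda>g. N #> g)"
proof -
  interpret N: normal N F by fact
  obtain Q :: "nat monoid" and \<pi> where Q: "finite_quotient_map \<Sigma> F T Q \<pi>"
    and ker: "\<And>u. u \<in> carrier F \<Longrightarrow> \<pi> u = \<pi> \<one> \<Longrightarrow> u \<in> N"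
    using neighbourhood_contains_fibre[OF op N.one_closed] by blast
  interpret \<pi>: group_hom F Q \<pi> using group_hom_finite_quotient_map[OF Q] .
  have eq: "N #> u = N #> v" if "u \<in> carrier F" "v \<in> carrier F" "\<pi> u = \<pi> v" for u v
  proof -
    have "\<pi> (u \<otimes> inv v) = \<pi> \<one>" using that by simp
    then have "u \<otimes> inv v \<in> N" using that by (intro ker) auto
    then have "u \<in> N #> v"
      using that N.rcos_module_rev[OF is_group] by blast
    then show ?thesis
      using repr_independence[OF _ that(2) N.is_subgroup] by simp
  qed
  \<comment> \<open>\<open>h\<close> is the factor map from the image of \<open>\<pi>\<close>,
    evaluated on a chosen preimage; by \<open>eq\<close> the choice does not matter.\<close>
  define h where "h q = N #> (SOME v. v \<in> carrier F \<and> \<pi> v = q)" for q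
  have h: "h (\<pi> u) = N #> u" if "u \<in> carrier F" for u
    unfolding h_def
  proof (rule eq)
    show "(SOME v. v \<in> carrier F \<and> \<pi> v = \<pi> u) \<in> carrier F"
      "\<pi> (SOME v. v \<in> carrier F \<and> \<pi> v = \<pi> u) = \<pi> u"
      using someI[of "\<lambda>v. v \<in> carrier F \<and> \<pi> v = \<pi> u" u] that by simp_all
  qed (fact that)
  have "locally_constant T (\<lambda>u. h (\<pi> u))"
    by (rule locally_constant_compose) (use Q in \<open>simp add: finite_quotient_map_def\<close>)
  then have lc: "locally_constant T (\<lambda>g. N #> g)"
    using h by (rule locally_constant_cong) simp
  have "finite_sigma_group \<Sigma> (Q\<lparr>carrier := \<pi> ` carrier F\<rparr>)"
    using Q \<pi>.img_is_subgroup by (intro finite_sigma_group_subgroup) (simp_all add: finite_quotient_map_def)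
  moreover have "h \<in> hom (Q\<lparr>carrier := \<pi> ` carrier F\<rparr>) (F Mod N)"
  proof (rule homI)
    fix a b assume "a \<in> carrier (Q\<lparr>carrier := \<pi> ` carrier F\<rparr>)" "b \<in> carrier (Q\<lparr>carrier := \<pi> ` carrier F\<rparr>)"
    then obtain u v where uv: "u \<in> carrier F" "v \<in> carrier F" "a = \<pi> u" "b = \<pi> v" by auto
    then have "a \<otimes>\<^bsub>Q\<^esub> b = \<pi> (u \<otimes> v)" by simp
    with uv show "h (a \<otimes>\<^bsub>Q\<lparr>carrier := \<pi> ` carrier F\<rparr>\<^esub> b) = h a \<otimes>\<^bsub>F Mod N\<^esub> h b"
      using h[of "u \<otimes> v"] by (simp add: h N.rcos_sum)
  qed (auto simp: h carrier_FactGroup)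
  moreover have "h ` carrier (Q\<lparr>carrier := \<pi> ` carrier F\<rparr>) = carrier (F Mod N)"
    by (auto simp: carrier_FactGroup image_image h cong: image_cong)
  ultimately have "finite_sigma_group \<Sigma> (F Mod N)"
    using finite_sigma_group_image[OF _ N.factorgroup_is_group] by blast
  then show ?thesis
    using lc N.r_coset_hom_Mod by (simp add: finite_quotient_map_def)
qed

text \<open>The set is the product of \<open>D k\<close> with the kernel of \<open>f\<close>, the
  smallest subgroup containing both. Dividing by it turns the image of \<open>f\<close> into its
  quotient by the image of \<open>D k\<close>.\<close>

lemma normal_open_saturation:
  assumes Q: "finite_quotient_map \<Sigma> F T Q f"
  shows "{g \<in> carrier F. f g \<in> f ` D k} \<lhd> F" "openin T {g \<in> carrier F. f g \<in> f ` D k}"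
proof -
  interpret f: group_hom F Q f using group_hom_finite_quotient_map[OF Q] .
  interpret d: subgroup "f ` D k" Q
    using f.subgroup_img_is_subgroup[OF subgroup_D] .
  let ?N = "{g \<in> carrier F. f g \<in> f ` D k}"
  show "?N \<lhd> F"
    unfolding normal_inv_iff
  proof (intro conjI ballI)
    show "subgroup ?N F"
      by (rule subgroupI) (auto intro!: exI[of _ \<one>] d.m_closed d.m_inv_closed)
    fix x g assume x: "x \<in> carrier F" and "g \<in> ?N"
    then obtain e where e: "e \<in> D k" "f g = f e" "g \<in> carrier F" by auto
    moreover have "x \<otimes> e \<otimes> inv x \<in> D k"
      by (rule normal.inv_op_closed2[OF normal_D x e(1)])
    moreover have "f (x \<otimes> g \<otimes> inv x) = f (x \<otimes> e \<otimes> inv x)"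
      using x e D_subset by (simp add: subset_eq)
    ultimately show "x \<otimes> g \<otimes> inv x \<in> ?N"
      using x by auto
  qed
  show "openin T ?N"
    using Q by (intro locally_constantD') (simp add: finite_quotient_map_def)
qed

text \<open>The closed subgroup \<open>D m\<close> is the intersection of the open normal subgroups
  above it; testing on the saturations of \<open>D m\<close> under maps to finite groups
  suffices.\<close>

lemma in_D_if_in_open_normal:
  assumes c: "c \<in> carrier F"
    and N: "\<And>N. N \<lhd> F \<Longrightarrow> openin T N \<Longrightarrow> D m \<subseteq> N \<Longrightarrow> c \<in> N"
  shows "c \<in> D m"
proof -
  have "\<pi> c \<in> \<pi> ` D m" if "finite_quotient_map \<Sigma> F T Q \<pi>" for Q :: "nat monoid" and \<pi>
    using N[OF normal_open_saturation[OF that]] D_subset by auto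
  then have "c \<in> T closure_of (D m)"
    using c by (simp add: in_closure_iff[OF D_subset])
  then show ?thesis
    using closedin_D closure_of_closedin by metis
qed

end

section \<open>Wreath products and cocycles\<close>

text \<open>The regular wreath product. The base group consists of extensional functions, so it is
  finite when \<open>A\<close> and \<open>P\<close> are; \<open>P\<close> acts on it by right
  translation of the argument.\<close>

definition wreath_product ::
    "('b, 'c) monoid_scheme \<Rightarrow> ('p, 'd) monoid_scheme \<Rightarrow> (('p \<Rightarrow> 'b) \<times> 'p) monoid" where
  "wreath_product A P =
     \<lparr>carrier = (carrier P \<rightarrow>\<^sub>E carrier A) \<times> carrier P,
      monoid.mult = (\<lambda>(u, p) (v, q). (\<lambda>r\<in>carrier P. u r \<otimes>\<^bsub>A\<^esub> v (r \<otimes>\<^bsub>P\<^esub> p), p \<otimes>\<^bsub>P\<^esub> q)),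
      one = (\<lambda>r\<in>carrier P. \<one>\<^bsub>A\<^esub>, \<one>\<^bsub>P\<^esub>)\<rparr>"

lemma group_wreath_product:
  assumes "group A" "group P"
  shows "group (wreath_product A P)"
proof -
  interpret A: group A by fact
  interpret P: group P by fact
  show ?thesis
  proof (rule groupI)
    fix x y assume "x \<in> carrier (wreath_product A P)" "y \<in> carrier (wreath_product A P)"
    then show "x \<otimes>\<^bsub>wreath_product A P\<^esub> y \<in> carrier (wreath_product A P)"
      by (auto simp: wreath_product_def PiE_iff)
  next
    fix x y z assume "x \<in> carrier (wreath_product A P)" "y \<in> carrier (wreath_product A P)"
      "z \<in> carrier (wreath_product A P)"
    then show "x \<otimes>\<^bsub>wreath_product A P\<^esub> y \<otimes>\<^bsub>wreath_product A P\<^esub> z =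
        x \<otimes>\<^bsub>wreath_product A P\<^esub> (y \<otimes>\<^bsub>wreath_product A P\<^esub> z)"
      by (auto simp: wreath_product_def PiE_iff A.m_assoc P.m_assoc intro!: restrict_ext)
  next
    fix x assume x: "x \<in> carrier (wreath_product A P)"
    obtain u p where x_eq: "x = (u, p)" by force
    have up: "\<And>r. r \<in> carrier P \<Longrightarrow> u r \<in> carrier A" "p \<in> carrier P" "u \<in> extensional (carrier P)"
      using x by (auto simp: wreath_product_def x_eq PiE_iff)
    show "\<one>\<^bsub>wreath_product A P\<^esub> \<otimes>\<^bsub>wreath_product A P\<^esub> x = x"
      using up by (auto simp: wreath_product_def x_eq fun_eq_iff extensional_def)
    show "\<exists>y\<in>carrier (wreath_product A P). y \<otimes>\<^bsub>wreath_product A P\<^esub> x = \<one>\<^bsub>wreath_product A P\<^esub>"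
    proof
      let ?y = "(\<lambda>r\<in>carrier P. inv\<^bsub>A\<^esub> u (r \<otimes>\<^bsub>P\<^esub> inv\<^bsub>P\<^esub> p), inv\<^bsub>P\<^esub> p)"
      show "?y \<in> carrier (wreath_product A P)"
        using up by (auto simp: wreath_product_def)
      show "?y \<otimes>\<^bsub>wreath_product A P\<^esub> x = \<one>\<^bsub>wreath_product A P\<^esub>"
        using up by (auto simp: wreath_product_def x_eq intro!: restrict_ext)
    qed
  qed (auto simp: wreath_product_def)
qed

lemma finite_sigma_group_wreath_product:
  assumes "finite_sigma_group \<Sigma> A" "finite_sigma_group \<Sigma> P"
  shows "finite_sigma_group \<Sigma> (wreath_product A P)"
proof -
  have fin: "finite (carrier A)" "finite (carrier P)"
    using assms by (auto simp: finite_sigma_group_def)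
  have "carrier (wreath_product A P) = (carrier P \<rightarrow>\<^sub>E carrier A) \<times> carrier P"
    by (simp add: wreath_product_def)
  moreover have "card (carrier P \<rightarrow>\<^sub>E carrier A) = card (carrier A) ^ card (carrier P)"
    using fin by (simp add: card_PiE)
  moreover have "finite (carrier P \<rightarrow>\<^sub>E carrier A)"
    using fin by (intro finite_PiE) auto
  moreover have "p \<in> \<Sigma>"
    if p: "Factorial_Ring.prime p" "p dvd card (carrier A) ^ card (carrier P) * card (carrier P)" for p
  proof -
    have "p dvd card (carrier A) \<or> p dvd card (carrier P)"
      using p by (meson prime_dvd_mult_iff prime_dvd_power_nat)
    then show ?thesis
      using assms p(1) by (auto simp: finite_sigma_group_def)
  qed
  ultimately show ?thesis
    using assms by (simp add: finite_sigma_group_def group_wreath_product card_cartesian_product)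
qed

text \<open>These are the function parts of homomorphisms to \<open>wreath_product A P\<close> with
  second component \<open>f\<close>. Only arguments in \<open>carrier P\<close> are constrained,
  hence the \<open>restrict\<close> wherever local constancy of \<open>b\<close> is stated.\<close>

definition cocycle ::
    "('a, 'e) monoid_scheme \<Rightarrow> ('p, 'd) monoid_scheme \<Rightarrow> ('b, 'c) monoid_scheme \<Rightarrow>
      ('a \<Rightarrow> 'p) \<Rightarrow> ('a \<Rightarrow> 'p \<Rightarrow> 'b) \<Rightarrow> bool" where
  "cocycle F P A f b \<longleftrightarrow>
     (\<forall>g\<in>carrier F. \<forall>r\<in>carrier P. b g r \<in> carrier A) \<and>
     (\<forall>g\<in>carrier F. \<forall>h\<in>carrier F. \<forall>r\<in>carrier P.
        b (g \<otimes>\<^bsub>F\<^esub> h) r = b g r \<otimes>\<^bsub>A\<^esub> b h (r \<otimes>\<^bsub>P\<^esub> f g))"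

lemma cocycle_closed:
  "cocycle F P A f b \<Longrightarrow> g \<in> carrier F \<Longrightarrow> r \<in> carrier P \<Longrightarrow> b g r \<in> carrier A"
  by (simp add: cocycle_def)

lemma cocycle_mult:
  "cocycle F P A f b \<Longrightarrow> g \<in> carrier F \<Longrightarrow> h \<in> carrier F \<Longrightarrow> r \<in> carrier P \<Longrightarrow>
    b (g \<otimes>\<^bsub>F\<^esub> h) r = b g r \<otimes>\<^bsub>A\<^esub> b h (r \<otimes>\<^bsub>P\<^esub> f g)"
  by (simp add: cocycle_def)

lemma cocycle_one:
  assumes "group_hom F P f" "group A" "cocycle F P A f b" "r \<in> carrier P"
  shows "b \<one>\<^bsub>F\<^esub> r = \<one>\<^bsub>A\<^esub>"
proof -
  interpret f: group_hom F P f by fact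
  interpret A: group A by fact
  have "b \<one>\<^bsub>F\<^esub> r = b \<one>\<^bsub>F\<^esub> r \<otimes>\<^bsub>A\<^esub> b \<one>\<^bsub>F\<^esub> r"
    using cocycle_mult[OF assms(3) f.G.one_closed f.G.one_closed assms(4)] assms(4) by simp
  then show ?thesis
    using cocycle_closed[OF assms(3) f.G.one_closed assms(4)] by (metis A.l_cancel_one')
qed

section \<open>Free pro-\<open>\<Sigma>\<close> groups\<close>

locale free_pro_sigma =
  fixes \<Sigma> :: "nat set" and F :: "'a monoid" (structure) and T :: "'a topology" and X :: "'a set"
  assumes sigma_prime: "\<And>p. p \<in> \<Sigma> \<Longrightarrow> Factorial_Ring.prime p"
    and sigma_nonempty: "\<Sigma> \<noteq> {}"
    and free: "free_pro_sigma_group \<Sigma> F T X"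

sublocale free_pro_sigma \<subseteq> pro_sigma
  using free by unfold_locales (simp add: free_pro_sigma_group_def)

context free_pro_sigma
begin

lemma X_subset: "X \<subseteq> carrier F"
  using free by (simp add: free_pro_sigma_group_def)

lemma X_closed: "x \<in> X \<Longrightarrow> x \<in> carrier F"
  using X_subset by blast

lemma closed_subgroup_eq_carrier:
  assumes "subgroup S F" "closedin T S" "X \<subseteq> S"
  shows "S = carrier F"
proof -
  have "generate F X \<subseteq> S"
    using assms(1,3) by (simp add: generate_subgroup_incl)
  then have "T closure_of generate F X \<subseteq> S"
    using assms(2) by (rule closure_of_minimal)
  then show ?thesis
    using free subgroup.subset[OF assms(1)]
    by (auto simp: free_pro_sigma_group_def topologically_generated_def)
qed

lemma finite_nontrivial_generators:
  assumes "finite_quotient_map \<Sigma> F T Q f"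
  shows "finite {x \<in> X. f x \<noteq> \<one>\<^bsub>Q\<^esub>}"
proof -
  let ?U = "{g \<in> carrier F. f g = \<one>\<^bsub>Q\<^esub>}"
  have "finite {x \<in> X. x \<notin> ?U}"
    using free normal_open_kernel[OF assms] normal_imp_subgroup
    unfolding free_pro_sigma_group_def converges_to_one_def by blast
  moreover have "{x \<in> X. x \<notin> ?U} = {x \<in> X. f x \<noteq> \<one>\<^bsub>Q\<^esub>}"
    using X_subset by auto
  ultimately show ?thesis by simp
qed

text \<open>The universal property freed from the type \<open>nat + 'a\<close>: \<open>Q\<close> is
  copied into the left summand and the resulting homomorphism is copied back.\<close>

lemma extend_to_hom:
  assumes Q: "finite_sigma_group \<Sigma> Q" and \<phi>: "\<And>x. x \<in> X \<Longrightarrow> \<phi> x \<in> carrier Q"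
    and fin: "finite {x \<in> X. \<phi> x \<noteq> \<one>\<^bsub>Q\<^esub>}"
  obtains f where "finite_quotient_map \<Sigma> F T Q f" "\<And>x. x \<in> X \<Longrightarrow> f x = \<phi> x"
proof -
  interpret Q: group Q using Q by (simp add: finite_sigma_group_def)
  obtain c0 :: "'b \<Rightarrow> nat" where c0: "inj_on c0 (carrier Q)"
    using finite_imp_inj_nat Q unfolding finite_sigma_group_def by metis
  define c :: "'b \<Rightarrow> nat + 'a" where "c = Inl \<circ> c0"
  have c: "inj_on c (carrier Q)"
    using c0 by (auto simp: c_def inj_on_def)
  let ?H = "transport_group c Q" and ?S = "discrete_topology (carrier (transport_group c Q))"
  have "pro_sigma_group \<Sigma> ?H ?S"
    using pro_sigma_group_discrete finite_sigma_group_transport_group[OF Q c] by blast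
  moreover have "(\<lambda>x. c (\<phi> x)) \<in> X \<rightarrow> carrier ?H"
    using \<phi> by simp
  moreover have "converges_to_one ?H ?S (\<lambda>x. c (\<phi> x)) X"
    unfolding converges_to_one_def
  proof (intro allI impI)
    fix U assume "subgroup U ?H \<and> openin ?S U"
    \<comment> \<open>Every subgroup contains the identity, so only generators with nontrivial value
      can fall outside \<open>U\<close>.\<close>
    then have "c \<one>\<^bsub>Q\<^esub> \<in> U"
      using subgroup.one_closed by fastforce
    then have "{x \<in> X. c (\<phi> x) \<notin> U} \<subseteq> {x \<in> X. \<phi> x \<noteq> \<one>\<^bsub>Q\<^esub>}" by auto
    then show "finite {x \<in> X. c (\<phi> x) \<notin> U}"
      using fin finite_subset by blast
  qed
  ultimately have "\<exists>!f. f \<in> topological_hom F T ?H ?S \<inter> extensional (carrier F) \<and> (\<forall>x\<in>X. f x = c (\<phi> x))"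
    using free unfolding free_pro_sigma_group_def by blast
  then obtain f0 where f0: "f0 \<in> hom F ?H" "continuous_map T ?S f0" "\<And>x. x \<in> X \<Longrightarrow> f0 x = c (\<phi> x)"
    unfolding topological_hom_def by blast
  have inv: "inv_into (carrier Q) c \<in> hom ?H Q"
    using c by (auto simp: hom_def)
  show thesis
  proof
    have "locally_constant T (\<lambda>x. inv_into (carrier Q) c (f0 x))"
      by (rule locally_constant_compose) (rule locally_constant_if_continuous[OF f0(2)])
    then show "finite_quotient_map \<Sigma> F T Q (\<lambda>x. inv_into (carrier Q) c (f0 x))"
      using Q Group.hom_compose[OF f0(1) inv] by (simp add: finite_quotient_map_def comp_def)
    show "inv_into (carrier Q) c (f0 x) = \<phi> x" if "x \<in> X" for x
      using f0(3)[OF that] \<phi>[OF that] c by simp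
  qed
qed

text \<open>The equalizer is a closed subgroup containing the generators. Asking that
  \<open>(f g, h g)\<close> lie in \<open>Id\<close> presents it as a preimage under a locally
  constant map.\<close>

lemma finite_quotient_map_agree:
  assumes f: "finite_quotient_map \<Sigma> F T Q f" and h: "finite_quotient_map \<Sigma> F T Q h"
    and X: "\<And>x. x \<in> X \<Longrightarrow> f x = h x" and g: "g \<in> carrier F"
  shows "f g = h g"
proof -
  interpret f: group_hom F Q f using group_hom_finite_quotient_map[OF f] .
  interpret h: group_hom F Q h using group_hom_finite_quotient_map[OF h] .
  let ?S = "{g \<in> carrier F. (f g, h g) \<in> Id}"
  have "?S = carrier F"
  proof (rule closed_subgroup_eq_carrier)
    show "subgroup ?S F"
      by (rule subgroupI) (auto intro!: exI[of _ \<one>])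
    show "closedin T ?S"
      using locally_constant_closedin[OF locally_constant_pair, of T f h Id] f h
      by (simp add: finite_quotient_map_def)
    show "X \<subseteq> ?S" using X X_closed by auto
  qed
  then show ?thesis using g by auto
qed

text \<open>The same argument for two cocycles over one \<open>f\<close>: the cocycle rule makes the
  elements on which they agree at every point a subgroup.\<close>

lemma cocycle_agree:
  assumes f: "finite_quotient_map \<Sigma> F T P f" and A: "group A"
    and b: "cocycle F P A f b" "locally_constant T (\<lambda>g. restrict (b g) (carrier P))"
    and c: "cocycle F P A f c" "locally_constant T (\<lambda>g. restrict (c g) (carrier P))"
    and X: "\<And>x r. x \<in> X \<Longrightarrow> r \<in> carrier P \<Longrightarrow> b x r = c x r"
    and g: "g \<in> carrier F" "r \<in> carrier P"
  shows "b g r = c g r"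
proof -
  interpret f: group_hom F P f using group_hom_finite_quotient_map[OF f] .
  interpret A: group A by fact
  let ?S = "{g \<in> carrier F. (restrict (b g) (carrier P), restrict (c g) (carrier P)) \<in> Id}"
  have S: "?S = {g \<in> carrier F. \<forall>r\<in>carrier P. b g r = c g r}"
    by (auto simp: fun_eq_iff restrict_def)
  have "?S = carrier F"
  proof (rule closed_subgroup_eq_carrier)
    show "closedin T ?S"
      using locally_constant_closedin[OF locally_constant_pair[OF b(2) c(2)], of Id] by simp
    show "X \<subseteq> ?S" unfolding S using X X_closed by auto
    show "subgroup ?S F"
      unfolding S
    proof (rule subgroupI)
      show "{g \<in> carrier F. \<forall>r\<in>carrier P. b g r = c g r} \<noteq> {}"
        using cocycle_one[OF f.group_hom_axioms A b(1)] cocycle_one[OF f.group_hom_axioms A c(1)]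
        by (auto intro!: exI[of _ \<one>])
    next
      fix g assume g: "g \<in> {g \<in> carrier F. \<forall>r\<in>carrier P. b g r = c g r}"
      have "b (inv g) r = c (inv g) r" if r: "r \<in> carrier P" for r
      proof -
        let ?s = "r \<otimes>\<^bsub>P\<^esub> f (inv g)"
        have s: "?s \<in> carrier P" using g r by simp
        \<comment> \<open>Both cocycles are trivial on \<open>inv g \<otimes> g\<close>, and the
          factor at \<open>?s\<close> is common to the two expansions, so it cancels.\<close>
        have "b (inv g) r \<otimes>\<^bsub>A\<^esub> b g ?s = b \<one> r" "c (inv g) r \<otimes>\<^bsub>A\<^esub> c g ?s = c \<one> r"
          using cocycle_mult[OF b(1), of "inv g" g r] cocycle_mult[OF c(1), of "inv g" g r] g r
          by simp_all
        then have "b (inv g) r \<otimes>\<^bsub>A\<^esub> b g ?s = c (inv g) r \<otimes>\<^bsub>A\<^esub> b g ?s"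
          using cocycle_one[OF f.group_hom_axioms A b(1) r] cocycle_one[OF f.group_hom_axioms A c(1) r]
            g s by simp
        then show ?thesis
          using cocycle_closed[OF b(1)] cocycle_closed[OF c(1)] g r s
          by (metis (no_types, lifting) A.right_cancel inv_closed mem_Collect_eq)
      qed
      then show "inv g \<in> {g \<in> carrier F. \<forall>r\<in>carrier P. b g r = c g r}"
        using g by simp
    next
      fix g h assume "g \<in> {g \<in> carrier F. \<forall>r\<in>carrier P. b g r = c g r}"
        "h \<in> {g \<in> carrier F. \<forall>r\<in>carrier P. b g r = c g r}"
      then show "g \<otimes> h \<in> {g \<in> carrier F. \<forall>r\<in>carrier P. b g r = c g r}"
        using cocycle_mult[OF b(1)] cocycle_mult[OF c(1)] by auto
    qed auto
  qed
  then show ?thesis using S g by blast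
qed

text \<open>The universal property gives a homomorphism to the wreath product with prescribed values
  on \<open>X\<close>; its second component is \<open>f\<close> by uniqueness. It maps
  \<open>D k\<close> into the base group, which is abelian, and hence kills
  \<open>D (Suc k)\<close>.\<close>

lemma cocycle_exists:
  assumes f: "finite_quotient_map \<Sigma> F T P f" and A: "finite_sigma_group \<Sigma> A" "comm_group A"
    and a: "\<And>x r. x \<in> X \<Longrightarrow> r \<in> carrier P \<Longrightarrow> a x r \<in> carrier A"
    and fin: "finite {x \<in> X. \<exists>r\<in>carrier P. a x r \<noteq> \<one>\<^bsub>A\<^esub>}"
    and D: "\<And>d. d \<in> D k \<Longrightarrow> f d = \<one>\<^bsub>P\<^esub>"
  obtains b where "cocycle F P A f b" "locally_constant T (\<lambda>g. restrict (b g) (carrier P))"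
    "\<And>x r. x \<in> X \<Longrightarrow> r \<in> carrier P \<Longrightarrow> b x r = a x r"
    "\<And>d r. d \<in> D (Suc k) \<Longrightarrow> r \<in> carrier P \<Longrightarrow> b d r = \<one>\<^bsub>A\<^esub>"
proof -
  interpret f: group_hom F P f using group_hom_finite_quotient_map[OF f] .
  interpret A: comm_group A by fact
  let ?W = "wreath_product A P"
  have P: "finite_sigma_group \<Sigma> P" using f by (simp add: finite_quotient_map_def)
  let ?\<phi> = "\<lambda>x. (restrict (a x) (carrier P), f x)"
  have "finite {x \<in> X. ?\<phi> x \<noteq> \<one>\<^bsub>?W\<^esub>}"
  proof (rule finite_subset)
    show "{x \<in> X. ?\<phi> x \<noteq> \<one>\<^bsub>?W\<^esub>} \<subseteq>
        {x \<in> X. \<exists>r\<in>carrier P. a x r \<noteq> \<one>\<^bsub>A\<^esub>} \<union> {x \<in> X. f x \<noteq> \<one>\<^bsub>P\<^esub>}"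
      by (auto simp: wreath_product_def fun_eq_iff)
    show "finite ({x \<in> X. \<exists>r\<in>carrier P. a x r \<noteq> \<one>\<^bsub>A\<^esub>} \<union> {x \<in> X. f x \<noteq> \<one>\<^bsub>P\<^esub>})"
      using fin finite_nontrivial_generators[OF f] by simp
  qed
  moreover have "?\<phi> x \<in> carrier ?W" if "x \<in> X" for x
    using a[OF that] X_closed[OF that] by (auto simp: wreath_product_def)
  ultimately obtain h where h: "finite_quotient_map \<Sigma> F T ?W h" "\<And>x. x \<in> X \<Longrightarrow> h x = ?\<phi> x"
    using extend_to_hom[OF finite_sigma_group_wreath_product[OF A(1) P], of ?\<phi>] by blast
  have hW: "h \<in> hom F ?W" and hlc: "locally_constant T h"
    using h(1) by (simp_all add: finite_quotient_map_def)
  have hc: "fst (h g) \<in> carrier P \<rightarrow>\<^sub>E carrier A" "snd (h g) \<in> carrier P" if "g \<in> carrier F" for g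
    using hom_in_carrier[OF hW that] by (auto simp: wreath_product_def)
  have hm: "fst (h (g \<otimes> g')) = (\<lambda>r\<in>carrier P. fst (h g) r \<otimes>\<^bsub>A\<^esub> fst (h g') (r \<otimes>\<^bsub>P\<^esub> snd (h g)))"
    "snd (h (g \<otimes> g')) = snd (h g) \<otimes>\<^bsub>P\<^esub> snd (h g')"
    if "g \<in> carrier F" "g' \<in> carrier F" for g g'
    using hom_mult[OF hW that] by (simp_all add: wreath_product_def case_prod_beta)
  have "locally_constant T (\<lambda>g. snd (h g))"
    by (rule locally_constant_compose[OF hlc])
  then have "finite_quotient_map \<Sigma> F T P (\<lambda>g. snd (h g))"
    using P hc hm by (simp add: finite_quotient_map_def hom_def)
  then have snd: "snd (h g) = f g" if "g \<in> carrier F" for g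
    using finite_quotient_map_agree[OF _ f _ that] h(2) by auto
  show thesis
  proof
    show "cocycle F P A f (\<lambda>g. fst (h g))"
      using hc hm snd by (auto simp: cocycle_def PiE_iff)
    have "locally_constant T (\<lambda>g. fst (h g))"
      by (rule locally_constant_compose[OF hlc])
    then show "locally_constant T (\<lambda>g. restrict (fst (h g)) (carrier P))"
      by (rule locally_constant_compose)
    show "fst (h x) r = a x r" if "x \<in> X" "r \<in> carrier P" for x r
      using h(2) that by simp
    fix d r assume d: "d \<in> D (Suc k)" and r: "r \<in> carrier P"
    have "h d = \<one>\<^bsub>?W\<^esub>"
    proof (rule trivial_on_D_Suc[OF h(1) _ d])
      fix d e assume d: "d \<in> D k" and e: "e \<in> D k"
      have F: "d \<in> carrier F" "e \<in> carrier F" using d e D_subset by auto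
      have "h (d \<otimes> e) = h (e \<otimes> d)"
      proof (rule prod_eqI)
        show "fst (h (d \<otimes> e)) = fst (h (e \<otimes> d))"
          using hc[OF F(1)] hc[OF F(2)]
          by (auto simp: hm F snd D[OF d] D[OF e] PiE_iff intro!: restrict_ext A.m_comm)
        show "snd (h (d \<otimes> e)) = snd (h (e \<otimes> d))"
          by (simp add: hm F snd D[OF d] D[OF e])
      qed
      then show "h d \<otimes>\<^bsub>?W\<^esub> h e = h e \<otimes>\<^bsub>?W\<^esub> h d"
        using hom_mult[OF hW] F by simp
    qed
    then show "fst (h d) r = \<one>\<^bsub>A\<^esub>"
      using r by (simp add: wreath_product_def)
  qed
qed

text \<open>The commutator is trivial under both \<open>f\<close> and \<open>b\<close>, so
  \<open>b\<close> agrees on \<open>g \<otimes> y\<close> and \<open>y \<otimes> g\<close>; the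
  cocycle rule expands both.\<close>

lemma cocycle_commute:
  assumes f: "finite_quotient_map \<Sigma> F T P f" and A: "group A" and b: "cocycle F P A f b"
    and D: "\<And>d. d \<in> D k \<Longrightarrow> f d = \<one>\<^bsub>P\<^esub>"
    and bD: "\<And>d r. d \<in> D (Suc k) \<Longrightarrow> r \<in> carrier P \<Longrightarrow> b d r = \<one>\<^bsub>A\<^esub>"
    and g: "g \<in> carrier F" and y: "y \<in> carrier F"
    and comm: "g \<otimes> y \<otimes> inv g \<otimes> inv y \<in> D (Suc k)" and r: "r \<in> carrier P"
  shows "b g r \<otimes>\<^bsub>A\<^esub> b y (r \<otimes>\<^bsub>P\<^esub> f g) = b y r \<otimes>\<^bsub>A\<^esub> b g (r \<otimes>\<^bsub>P\<^esub> f y)"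
proof -
  interpret f: group_hom F P f using group_hom_finite_quotient_map[OF f] .
  interpret A: group A by fact
  let ?c = "g \<otimes> y \<otimes> inv g \<otimes> inv y"
  have eq: "g \<otimes> y = ?c \<otimes> (y \<otimes> g)"
    using g y by (simp add: m_assoc) (simp flip: m_assoc)
  have "f ?c = \<one>\<^bsub>P\<^esub>"
    using D comm D_Suc_subset by blast
  then have "b (?c \<otimes> (y \<otimes> g)) r = b (y \<otimes> g) r"
    using cocycle_mult[OF b, of ?c "y \<otimes> g" r] cocycle_closed[OF b, of "y \<otimes> g" r] g y r bD[OF comm r]
    by simp
  then have "b (g \<otimes> y) r = b (y \<otimes> g) r"
    using eq by metis
  then show ?thesis
    using cocycle_mult[OF b] g y r by metis
qed

end

section \<open>Products of periodic functions\<close>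

text \<open>Compare multiplicities at each prime \<open>p\<close>. If \<open>p\<close> divides
  \<open>e\<close>, the multiplicity v of \<open>p\<close> in \<open>g\<close> satisfies v < p^v
  \<le> d, while \<open>e ^ d\<close> has multiplicity at least \<open>d\<close>. Otherwise
  \<open>p\<close> divides neither \<open>e ^ Suc d\<close> nor \<open>g\<close>.\<close>

lemma dvd_power_if_dvd_power_Suc:
  fixes g d e :: nat
  assumes "g dvd d" "g dvd e ^ Suc d" "d > 0" "e > 0"
  shows "g dvd e ^ d"
proof (rule multiplicity_le_imp_dvd)
  show "g \<noteq> 0" using assms by auto
  fix p :: nat assume p: "Factorial_Ring.prime p"
  show "multiplicity p g \<le> multiplicity p (e ^ d)"
  proof (cases "p dvd e")
    case True
    have "p ^ multiplicity p g dvd d"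
      using assms(1) multiplicity_dvd dvd_trans by blast
    then have "p ^ multiplicity p g \<le> d"
      using assms(3) by (simp add: dvd_imp_le)
    moreover have "multiplicity p g < p ^ multiplicity p g"
      using p by (intro power_gt_expt) (simp add: prime_gt_Suc_0_nat)
    moreover have "multiplicity p e > 0"
      using True p assms(4) by (simp add: prime_multiplicity_gt_zero_iff)
    ultimately show ?thesis
      using p assms(4)
      by (simp add: prime_elem_multiplicity_power_distrib)
        (metis le_trans less_imp_le_nat mult_le_mono2 nat_mult_1_right Suc_leI One_nat_def)
  next
    case False
    then have "multiplicity p (e ^ Suc d) = 0"
      using p by (metis not_dvd_imp_multiplicity_0 prime_dvd_power_nat)
    moreover have "multiplicity p g \<le> multiplicity p (e ^ Suc d)"
      using assms by (intro dvd_imp_multiplicity_le) auto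
    ultimately show ?thesis by simp
  qed
qed

lemma periodic_mult:
  fixes \<gamma> :: "int \<Rightarrow> 'b"
  assumes "\<And>z. \<gamma> (z + d) = \<gamma> z"
  shows "\<gamma> (z + k * d) = \<gamma> z"
proof (induction k arbitrary: z rule: int_induct[of _ 0])
  case base
  then show ?case by simp
next
  case (step1 i)
  then show ?case
    using assms[of "z + i * d"] by (simp add: algebra_simps)
next
  case (step2 i)
  then show ?case
    using assms[of "z + (i - 1) * d"] by (simp add: algebra_simps)
qed

text \<open>The interval splits into \<open>q\<close> translates of a full period.\<close>

lemma (in comm_group) finprod_periodic_power:
  fixes \<gamma> :: "int \<Rightarrow> 'a"
  assumes "\<And>z. \<gamma> z \<in> carrier G" "\<And>z. \<gamma> (z + int g) = \<gamma> z"
  shows "finprod G \<gamma> {0..<int (g * q)} = finprod G \<gamma> {0..<int g} [^] q"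
proof (induction q)
  case 0
  then show ?case by simp
next
  case (Suc q)
  have split: "{0..<int (g * Suc q)} = {0..<int (g * q)} \<union> (\<lambda>z. z + int (g * q)) ` {0..<int g}"
    using ivl_disj_un_two(3)[of 0 "int (g * q)" "int (g * Suc q)"] by (simp add: algebra_simps)
  have per: "\<gamma> (z + int (g * q)) = \<gamma> z" for z
    using periodic_mult[of \<gamma> "int g" z "int q"] assms(2) by (simp add: mult.commute)
  have "finprod G \<gamma> {0..<int (g * Suc q)} =
      finprod G \<gamma> {0..<int (g * q)} \<otimes> finprod G \<gamma> ((\<lambda>z. z + int (g * q)) ` {0..<int g})"
    unfolding split using assms(1) by (intro finprod_Un_disjoint) auto
  also have "finprod G \<gamma> ((\<lambda>z. z + int (g * q)) ` {0..<int g}) =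
      finprod G (\<lambda>z. \<gamma> (z + int (g * q))) {0..<int g}"
    using assms(1) by (intro finprod_reindex) (auto simp: inj_on_def)
  also have "\<dots> = finprod G \<gamma> {0..<int g}"
    by (simp only: per)
  finally show ?case
    using Suc assms(1) by (simp add: nat_pow_Suc)
qed

text \<open>The exponent \<open>d + 1\<close> makes \<open>M / gcd d M\<close> a multiple of the order of the group.\<close>

lemma (in comm_group) finprod_periodic:
  fixes \<gamma> :: "int \<Rightarrow> 'a"
  assumes \<gamma>: "\<And>z. \<gamma> z \<in> carrier G" and fin: "finite (carrier G)" and d: "d > 0"
    and M: "M = card (carrier G) ^ Suc d"
    and perd: "\<And>z. \<gamma> (z + int d) = \<gamma> z" and perM: "\<And>z. \<gamma> (z + int M) = \<gamma> z"
  shows "finprod G \<gamma> {0..<int M} = \<one>"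
proof -
  let ?e = "card (carrier G)" and ?g = "gcd d M"
  have e: "?e > 0" using fin by (auto simp: card_gt_0_iff)
  have "\<exists>u v. u * int d + v * int M = int ?g"
    using bezout_int[of "int d" "int M"] by simp
  then obtain u v where uv: "u * int d + v * int M = int ?g" by blast
  \<comment> \<open>By Bezout the two periods combine to their gcd.\<close>
  have perg: "\<gamma> (z + int ?g) = \<gamma> z" for z
    using periodic_mult[of \<gamma> "int d" "z" u, OF perd]
      periodic_mult[of \<gamma> "int M" "z + u * int d" v, OF perM] by (simp add: uv add.assoc)
  obtain q where q: "M = ?g * q"
    using gcd_dvd2 by (rule dvdE)
  \<comment> \<open>Since the gcd already divides \<open>?e ^ d\<close>, the remaining factor
    \<open>?e\<close> of \<open>M\<close> makes the number \<open>q\<close> of periods a multiple of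
    the group order.\<close>
  have "?g dvd ?e ^ d"
    using gcd_dvd1[of d M] gcd_dvd2[of d M] d e unfolding M by (rule dvd_power_if_dvd_power_Suc)
  then obtain s where s: "?e ^ d = ?g * s" by (rule dvdE)
  have "?g * q = ?g * (s * ?e)"
    using q s M by (metis mult.assoc mult.commute power_Suc)
  then have q': "q = s * ?e" using d by simp
  let ?s = "finprod G \<gamma> {0..<int ?g}"
  have sc: "?s \<in> carrier G" using \<gamma> by (intro finprod_closed) auto
  have "finprod G \<gamma> {0..<int M} = finprod G \<gamma> {0..<int (?g * q)}"
    using q by simp
  also have "\<dots> = ?s [^] q"
    by (rule finprod_periodic_power) (rule \<gamma>, rule perg)
  also have "\<dots> = (?s [^] ?e) [^] s"
    unfolding q' using sc by (simp add: nat_pow_pow mult.commute)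
  also have "\<dots> = \<one>"
    using power_order_eq_one[OF fin sc] by simp
  finally show ?thesis .
qed

section \<open>Elements commuting with a power of a free generator\<close>

context free_pro_sigma
begin

text \<open>The cocycle \<open>b\<close> is the Fox derivative with respect to \<open>x\<close>,
  modulo \<open>M\<close>: \<open>b g r\<close> is its coefficient at the inverse of
  \<open>r\<close>. On \<open>x [^] i\<close> it is supported in the cyclic subgroup
  \<open>?C\<close> with total \<open>i\<close>. A commuting \<open>g\<close> with image outside
  \<open>?C\<close> would move this support off \<open>?C\<close> and leave \<open>n\<close>
  congruent to 0.\<close>

lemma image_in_cyclic_if_commute:
  fixes n :: nat
  assumes f: "finite_quotient_map \<Sigma> F T P f" and D: "\<And>d. d \<in> D k \<Longrightarrow> f d = \<one>\<^bsub>P\<^esub>"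
    and x: "x \<in> X" and g: "g \<in> carrier F" and n: "n > 0"
    and comm: "g \<otimes> x [^] n \<otimes> inv g \<otimes> inv (x [^] n) \<in> D (Suc k)"
  shows "f g \<in> generate P {f x}"
proof (rule ccontr)
  assume notin: "f g \<notin> generate P {f x}"
  interpret f: group_hom F P f using group_hom_finite_quotient_map[OF f] .
  have xF: "x \<in> carrier F" using X_closed[OF x] .
  obtain p where p: "p \<in> \<Sigma>" using sigma_nonempty by blast
  then have pp: "Factorial_Ring.prime p" using sigma_prime by simp
  \<comment> \<open>A power of \<open>p\<close> exceeding \<open>n\<close>, so that \<open>M\<close>
    cannot divide \<open>n\<close>.\<close>
  define M where "M = p ^ n"
  have nM: "n < M"
    unfolding M_def using pp by (intro power_gt_expt) (simp add: prime_gt_Suc_0_nat)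
  let ?A = "integer_mod_group M"
  have M1: "M > 1" using nM n by simp
  have A: "finite_sigma_group \<Sigma> ?A"
  proof (rule finite_sigma_group_integer_mod_group)
    show "M > 0" using M1 by simp
    fix q assume "Factorial_Ring.prime q" "q dvd M"
    then have "q = p"
      unfolding M_def using pp by (metis prime_dvd_power_nat primes_dvd_imp_eq)
    then show "q \<in> \<Sigma>" using p by simp
  qed
  define a where "a y r = (if y = x \<and> r = \<one>\<^bsub>P\<^esub> then 1 else 0 :: int)" for y r
  have fin: "finite {y \<in> X. \<exists>r\<in>carrier P. a y r \<noteq> \<one>\<^bsub>?A\<^esub>}"
    by (rule finite_subset[of _ "{x}"]) (auto simp: a_def)
  have aA: "a y r \<in> carrier ?A" for y r
    using M1 by (simp add: a_def carrier_integer_mod_group)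
  obtain b where b: "cocycle F P ?A f b" "locally_constant T (\<lambda>g. restrict (b g) (carrier P))"
    and bX: "\<And>y r. y \<in> X \<Longrightarrow> r \<in> carrier P \<Longrightarrow> b y r = a y r"
    and bD: "\<And>d r. d \<in> D (Suc k) \<Longrightarrow> r \<in> carrier P \<Longrightarrow> b d r = \<one>\<^bsub>?A\<^esub>"
    using cocycle_exists[OF f A abelian_integer_mod_group aA fin D] by blast
  have bmult: "b (u \<otimes> v) r = (b u r + b v (r \<otimes>\<^bsub>P\<^esub> f u)) mod int M"
    if "u \<in> carrier F" "v \<in> carrier F" "r \<in> carrier P" for u v r
    using cocycle_mult[OF b(1) that] by simp
  have b1: "b \<one> r = 0" if "r \<in> carrier P" for r
    using cocycle_one[OF f.group_hom_axioms group_integer_mod_group b(1) that] by simp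
  let ?C = "generate P {f x}"
  have C: "subgroup ?C P"
    using xF by (intro f.H.generate_is_subgroup) simp
  interpret C: subgroup ?C P by (rule C)
  have xC: "f x \<in> ?C" by (simp add: generate.incl)
  have finP: "finite (carrier P)"
    using f by (simp add: finite_quotient_map_def finite_sigma_group_def)
  then have finC: "finite ?C" using C.subset finite_subset by blast
  have CP: "r \<in> carrier P" if "r \<in> ?C" for r using C.subset that by blast
  \<comment> \<open>Right translation by an element of \<open>?C\<close> permutes \<open>?C\<close>.
    The sums are taken over integer representatives, which is why the relations below are
    congruences modulo \<open>M\<close>.\<close>
  have shift: "(\<Sum>r\<in>?C. w (r \<otimes>\<^bsub>P\<^esub> c)) = (\<Sum>r\<in>?C. w r)" if c: "c \<in> ?C" for c and w :: "_ \<Rightarrow> int"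
  proof (rule sum.reindex_bij_betw)
    show "bij_betw (\<lambda>r. r \<otimes>\<^bsub>P\<^esub> c) ?C ?C"
      by (rule bij_betw_byWitness[where f' = "\<lambda>r. r \<otimes>\<^bsub>P\<^esub> inv\<^bsub>P\<^esub> c"])
        (use c CP in \<open>auto simp: f.H.m_assoc\<close>)
  qed
  have sum_x: "(\<Sum>r\<in>?C. b x r) = 1"
    using bX[OF x] CP finC C.one_closed by (simp add: a_def sum.delta cong: sum.cong)
  have xSuc: "x [^] Suc i = x \<otimes> x [^] i" for i :: nat
    by (rule nat_pow_Suc2[OF xF])
  have sum_pow: "[(\<Sum>r\<in>?C. b (x [^] i) r) = int i] (mod int M)" for i :: nat
  proof (induction i)
    case 0
    then show ?case by (simp add: b1 CP)
  next
    case (Suc i)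
    have "[(\<Sum>r\<in>?C. b (x [^] Suc i) r) = (\<Sum>r\<in>?C. b x r + b (x [^] i) (r \<otimes>\<^bsub>P\<^esub> f x))] (mod int M)"
      unfolding xSuc using xF by (intro cong_sum) (simp add: bmult CP cong_def)
    also have "(\<Sum>r\<in>?C. b x r + b (x [^] i) (r \<otimes>\<^bsub>P\<^esub> f x)) = 1 + (\<Sum>r\<in>?C. b (x [^] i) r)"
      by (simp add: sum.distrib sum_x shift[OF xC])
    also have "[1 + (\<Sum>r\<in>?C. b (x [^] i) r) = 1 + int i] (mod int M)"
      using Suc by (intro cong_add) auto
    finally show ?case by simp
  qed
  \<comment> \<open>Off \<open>?C\<close>, translating by \<open>f x\<close> never reaches the
    identity, the only point where \<open>b x\<close> is nonzero.\<close>
  have outside: "b (x [^] i) r = 0" if "r \<in> carrier P" "r \<notin> ?C" for i :: nat and r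
    using that
  proof (induction i arbitrary: r)
    case 0
    then show ?case by (simp add: b1)
  next
    case (Suc i)
    have "r \<otimes>\<^bsub>P\<^esub> f x \<notin> ?C"
    proof
      assume "r \<otimes>\<^bsub>P\<^esub> f x \<in> ?C"
      then have "r \<otimes>\<^bsub>P\<^esub> f x \<otimes>\<^bsub>P\<^esub> inv\<^bsub>P\<^esub> f x \<in> ?C"
        by (rule C.m_closed[OF _ C.m_inv_closed[OF xC]])
      then show False using Suc.prems xF by (simp add: f.H.m_assoc)
    qed
    then have "b (x [^] i) (r \<otimes>\<^bsub>P\<^esub> f x) = 0"
      using Suc xF by simp
    moreover have "b x r = 0"
      using bX[OF x] Suc.prems C.one_closed by (auto simp: a_def)
    ultimately show ?case
      unfolding xSuc using bmult[OF xF, of "x [^] i" r] Suc.prems xF by simp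
  qed
  let ?y = "x [^] n"
  have yF: "?y \<in> carrier F" using xF by simp
  have yC: "f ?y \<in> ?C"
    using f.H.subgroup_int_pow_closed[OF C xC, of "int n"] xF by (simp add: f.hom_nat_pow int_pow_int)
  \<comment> \<open>The sums of \<open>b g\<close> cancel by translation invariance, as
    \<open>f ?y\<close> lies in \<open>?C\<close>; the other term on the left vanishes by
    \<open>outside\<close>. What remains is the total of \<open>b ?y\<close>, which is congruent to
    \<open>n\<close>.\<close>
  have "[(\<Sum>r\<in>?C. b g r + b ?y (r \<otimes>\<^bsub>P\<^esub> f g)) = (\<Sum>r\<in>?C. b ?y r + b g (r \<otimes>\<^bsub>P\<^esub> f ?y))] (mod int M)"
  proof (intro cong_sum)
    fix r assume "r \<in> ?C"
    then show "[b g r + b ?y (r \<otimes>\<^bsub>P\<^esub> f g) = b ?y r + b g (r \<otimes>\<^bsub>P\<^esub> f ?y)] (mod int M)"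
      using cocycle_commute[OF f group_integer_mod_group b(1) D bD g yF comm CP]
      by (simp add: cong_def)
  qed
  moreover have "b ?y (r \<otimes>\<^bsub>P\<^esub> f g) = 0" if r: "r \<in> ?C" for r
  proof (rule outside)
    show "r \<otimes>\<^bsub>P\<^esub> f g \<in> carrier P" using CP[OF r] g by simp
    show "r \<otimes>\<^bsub>P\<^esub> f g \<notin> ?C"
    proof
      assume "r \<otimes>\<^bsub>P\<^esub> f g \<in> ?C"
      then have "inv\<^bsub>P\<^esub> r \<otimes>\<^bsub>P\<^esub> (r \<otimes>\<^bsub>P\<^esub> f g) \<in> ?C"
        by (rule C.m_closed[OF C.m_inv_closed[OF r]])
      then show False using notin CP[OF r] g by (simp flip: f.H.m_assoc)
    qed
  qed
  ultimately have "[(\<Sum>r\<in>?C. b g r) = (\<Sum>r\<in>?C. b ?y r) + (\<Sum>r\<in>?C. b g r)] (mod int M)"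
    by (simp add: sum.distrib shift[OF yC])
  then have "[0 = (\<Sum>r\<in>?C. b ?y r)] (mod int M)"
    by (metis add.left_neutral cong_add_rcancel)
  then have "[0 = int n] (mod int M)"
    using sum_pow[of n] cong_trans by blast
  then have "M dvd n"
    by (metis cong_0_iff cong_sym int_dvd_int_iff)
  then show False
    using nM n by (simp add: nat_dvd_not_less)
qed

text \<open>The exponent sum in \<open>x\<close> modulo \<open>M\<close>. The value at
  \<open>x\<close> is written \<open>1 mod int M\<close> because it is 0 when
  \<open>M = 1\<close>.\<close>

lemma hom_to_cyclic:
  assumes M: "M > 0" "\<And>p. Factorial_Ring.prime p \<Longrightarrow> p dvd M \<Longrightarrow> p \<in> \<Sigma>"
    and x: "x \<in> X"
  obtains z where "finite_quotient_map \<Sigma> F T (integer_mod_group M) z" "z x = 1 mod int M"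
    "\<And>y. y \<in> X \<Longrightarrow> y \<noteq> x \<Longrightarrow> z y = 0" "\<And>k d. d \<in> D (Suc k) \<Longrightarrow> z d = 0"
proof -
  let ?A = "integer_mod_group M"
  have "finite {y \<in> X. (if y = x then 1 mod int M else 0) \<noteq> \<one>\<^bsub>?A\<^esub>}"
    by (rule finite_subset[of _ "{x}"]) auto
  moreover have "(if y = x then 1 mod int M else 0) \<in> carrier ?A" for y
    using M(1) by (simp add: carrier_integer_mod_group)
  ultimately obtain z where z: "finite_quotient_map \<Sigma> F T ?A z"
    "\<And>y. y \<in> X \<Longrightarrow> z y = (if y = x then 1 mod int M else 0)"
    using extend_to_hom[OF finite_sigma_group_integer_mod_group[OF M], of "\<lambda>y. if y = x then 1 mod int M else 0"]
    by blast
  show thesis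
  proof
    show "finite_quotient_map \<Sigma> F T ?A z" "z x = 1 mod int M"
      "\<And>y. y \<in> X \<Longrightarrow> y \<noteq> x \<Longrightarrow> z y = 0"
      using z x by auto
    show "z d = 0" if "d \<in> D (Suc k)" for k d
      using trivial_on_D_Suc[OF z(1) _ that] by (simp add: add.commute)
  qed
qed

text \<open>Carries out the second half of the argument for \<open>Q = F Mod N\<close>: the cocycle
  describing \<open>Q\<close> is a product over fibres of a cocycle on \<open>P'\<close>, and
  periodicity makes this product trivial at the corrected element \<open>h\<close>.\<close>

lemma in_open_normal_times_power:
  fixes n :: nat
  assumes N: "N \<lhd> F" "openin T N" "D (Suc (Suc j)) \<subseteq> N"
    and x: "x \<in> X" and g: "g \<in> carrier F" and n: "n > 0"
    and comm: "g \<otimes> x [^] n \<otimes> inv g \<otimes> inv (x [^] n) \<in> D (Suc (Suc j))"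
  obtains a :: int where "g \<otimes> inv (x [^] a) \<in> N"
proof -
  let ?k = "Suc j"
  have xF: "x \<in> carrier F" using X_closed[OF x] .
  interpret N: normal N F by (rule N(1))
  define Q where "Q = F Mod N"
  define f where "f = (\<lambda>g. N #> g)"
  have f: "finite_quotient_map \<Sigma> F T Q f"
    unfolding Q_def f_def using finite_quotient_map_Mod N by blast
  interpret f: group_hom F Q f using group_hom_finite_quotient_map[OF f] .
  have f1: "f u = \<one>\<^bsub>Q\<^esub> \<longleftrightarrow> u \<in> N" if "u \<in> carrier F" for u
    using r_coset_eq_self_iff[OF normal_imp_subgroup[OF N(1)] that] by (simp add: f_def Q_def)
  \<comment> \<open>The preimage of the image of \<open>D ?k\<close> in \<open>Q\<close>, so that
    \<open>P\<close> is \<open>Q\<close> modulo that image.\<close>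
  define K where "K = {g \<in> carrier F. f g \<in> f ` D ?k}"
  have K: "K \<lhd> F" "openin T K"
    unfolding K_def using normal_open_saturation[OF f] by blast+
  interpret K: normal K F by (rule K(1))
  define P where "P = F Mod K"
  define c where "c = (\<lambda>g. K #> g)"
  have c: "finite_quotient_map \<Sigma> F T P c"
    unfolding P_def c_def using finite_quotient_map_Mod K by blast
  interpret c: group_hom F P c using group_hom_finite_quotient_map[OF c] .
  have c1: "c u = \<one>\<^bsub>P\<^esub> \<longleftrightarrow> u \<in> K" if "u \<in> carrier F" for u
    using r_coset_eq_self_iff[OF normal_imp_subgroup[OF K(1)] that] by (simp add: c_def P_def)
  have cD: "c d = \<one>\<^bsub>P\<^esub>" if "d \<in> D ?k" for d
    using that D_subset c1[of d] unfolding K_def by blast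
  have finP: "finite (carrier P)" "finite_sigma_group \<Sigma> P"
    using c by (auto simp: finite_quotient_map_def finite_sigma_group_def)

  define A where "A = Q\<lparr>carrier := f ` D ?k\<rparr>"
  have subA: "subgroup (f ` D ?k) Q"
    using f.subgroup_img_is_subgroup[OF subgroup_D] .
  have A_sigma: "finite_sigma_group \<Sigma> A"
    unfolding A_def using f subA by (intro finite_sigma_group_subgroup) (simp_all add: finite_quotient_map_def)
  then have A_group: "group A" by (simp add: finite_sigma_group_def)
  have A_simps: "carrier A = f ` D ?k" "\<one>\<^bsub>A\<^esub> = \<one>\<^bsub>Q\<^esub>" "u \<otimes>\<^bsub>A\<^esub> v = u \<otimes>\<^bsub>Q\<^esub> v" for u v
    by (simp_all add: A_def)
  \<comment> \<open>Commutators of elements of \<open>D ?k\<close> lie in \<open>D (Suc ?k)\<close>,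
    which is contained in \<open>N\<close>.\<close>
  have A_comm: "comm_group A"
  proof (rule group.group_comm_groupI[OF A_group])
    fix u v assume "u \<in> carrier A" "v \<in> carrier A"
    then obtain d e where de: "d \<in> D ?k" "e \<in> D ?k" "u = f d" "v = f e"
      by (auto simp: A_simps)
    have F: "d \<in> carrier F" "e \<in> carrier F" using de D_subset by blast+
    have "f (d \<otimes> e \<otimes> inv d \<otimes> inv e) = \<one>\<^bsub>Q\<^esub>"
      using commutator_in_D_Suc[OF de(1,2)] N(3) F by (subst f1) auto
    then have "f ((d \<otimes> e) \<otimes> inv (e \<otimes> d)) = \<one>\<^bsub>Q\<^esub>"
      using F by (simp add: inv_mult_group m_assoc)
    then have "f (d \<otimes> e) = f (e \<otimes> d)"
      using F by (metis f.H.inv_solve_right' f.H.l_one f.H.one_closed f.hom_closed f.hom_inv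
          f.hom_mult inv_closed m_closed)
    then show "u \<otimes>\<^bsub>A\<^esub> v = v \<otimes>\<^bsub>A\<^esub> u"
      using F by (simp add: A_simps de)
  qed
  interpret A: comm_group A by (rule A_comm)
  have finA: "finite (carrier A)" and A_pos: "card (carrier A) > 0"
    using A_sigma A.one_closed by (auto simp: finite_sigma_group_def card_gt_0_iff)

  \<comment> \<open>With this \<open>d\<close>, the element \<open>x [^] d\<close> is a power of
    \<open>x [^] n\<close> that is trivial in \<open>P\<close>: translation by it changes only the
    cyclic coordinate of \<open>P'\<close>, by \<open>d\<close>.\<close>
  define d where "d = n * card (carrier P)"
  have d: "d > 0"
    using n finP(1) c.H.one_closed by (auto simp: d_def card_gt_0_iff)
  \<comment> \<open>The modulus required by \<open>finprod_periodic\<close>. Its prime factors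
    divide the order of \<open>A\<close>, hence lie in \<Sigma>.\<close>
  define M where "M = card (carrier A) ^ Suc d"
  have M: "M > 0" using A_pos by (simp add: M_def)
  have M_sigma: "p \<in> \<Sigma>" if "Factorial_Ring.prime p" "p dvd M" for p
    using that prime_dvd_power_nat[of p "card (carrier A)" "Suc d"] A_sigma
    by (auto simp: M_def finite_sigma_group_def)
  let ?Z = "integer_mod_group M"
  obtain z where z: "finite_quotient_map \<Sigma> F T ?Z z" and zx: "z x = 1 mod int M"
    and zD: "\<And>k d. d \<in> D (Suc k) \<Longrightarrow> z d = 0"
    using hom_to_cyclic[OF M M_sigma x] by metis
  interpret z: group_hom F ?Z z using group_hom_finite_quotient_map[OF z] .
  define P' where "P' = P \<times>\<times> ?Z"
  define f' where "f' = (\<lambda>g. (c g, z g))"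
  have f': "finite_quotient_map \<Sigma> F T P' f'"
    unfolding P'_def f'_def by (rule finite_quotient_map_pair[OF c z])
  interpret f': group_hom F P' f' using group_hom_finite_quotient_map[OF f'] .
  have f'D: "f' d = \<one>\<^bsub>P'\<^esub>" if "d \<in> D ?k" for d
    using that cD zD by (simp add: f'_def P'_def)
  have P'_car: "carrier P' = carrier P \<times> {0..<int M}"
    using M by (simp add: P'_def carrier_integer_mod_group)

  have "f' g \<in> generate P' {f' x}"
    by (rule image_in_cyclic_if_commute[OF f' f'D x g n comm])
  then obtain a :: int where a: "f' g = f' x [^]\<^bsub>P'\<^esub> a"
    using f'.H.generate_pow[of "f' x"] xF by auto
  \<comment> \<open>The correction by a power of \<open>x\<close> makes the element trivial in
    \<open>P'\<close> and leaves its commutator with \<open>x [^] n\<close> unchanged.\<close>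
  define h where "h = g \<otimes> inv (x [^] a)"
  have hF: "h \<in> carrier F" using g xF by (simp add: h_def)
  have f'h: "f' h = \<one>\<^bsub>P'\<^esub>"
    using g xF a by (simp add: h_def f'.hom_int_pow)
  let ?y = "x [^] n"
  have yF: "?y \<in> carrier F" using xF by simp
  have "inv (x [^] a) \<otimes> ?y = ?y \<otimes> inv (x [^] a)"
  proof -
    have "inv (x [^] a) = x [^] (- a)" "?y = x [^] int n"
      using xF by (simp_all add: int_pow_neg int_pow_int)
    then show ?thesis
      using xF by (metis int_pow_mult add.commute)
  qed
  then have "h \<otimes> ?y \<otimes> inv h = g \<otimes> ?y \<otimes> inv g"
    using g xF yF by (simp add: h_def inv_mult_group m_assoc) (simp flip: m_assoc)
  then have commh: "h \<otimes> ?y \<otimes> inv h \<otimes> inv ?y \<in> D (Suc ?k)"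
    using comm by simp

  define t where "t r = (SOME v. v \<in> carrier F \<and> c v = r)" for r
  have t: "t r \<in> carrier F" "c (t r) = r" if "r \<in> carrier P" for r
  proof -
    have "\<exists>v. v \<in> carrier F \<and> c v = r"
      using that by (auto simp: P_def c_def carrier_FactGroup)
    then show "t r \<in> carrier F" "c (t r) = r"
      unfolding t_def by (metis (mono_tags, lifting) someI_ex)+
  qed
  \<comment> \<open>The Kaloujnine--Krasner embedding of \<open>Q\<close> into the wreath product of \<open>A\<close> and \<open>P\<close>.\<close>
  define u where "u g r = f (t r \<otimes> g \<otimes> inv (t (r \<otimes>\<^bsub>P\<^esub> c g)))" for g r
  have u: "cocycle F P A c u"
    unfolding cocycle_def
  proof (intro conjI ballI)
    fix g r assume g: "g \<in> carrier F" and r: "r \<in> carrier P"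
    have s: "r \<otimes>\<^bsub>P\<^esub> c g \<in> carrier P" using g r by simp
    have "c (t r \<otimes> g \<otimes> inv (t (r \<otimes>\<^bsub>P\<^esub> c g))) = \<one>\<^bsub>P\<^esub>"
      using g r s t by simp
    then have "t r \<otimes> g \<otimes> inv (t (r \<otimes>\<^bsub>P\<^esub> c g)) \<in> K"
      using g r s t by (subst (asm) c1) simp_all
    then show "u g r \<in> carrier A"
      unfolding u_def K_def A_simps by blast
    fix g' assume g': "g' \<in> carrier F"
    have s': "r \<otimes>\<^bsub>P\<^esub> c g \<otimes>\<^bsub>P\<^esub> c g' \<in> carrier P" using g g' r by simp
    let ?t = "t (r \<otimes>\<^bsub>P\<^esub> c g)" and ?t' = "t (r \<otimes>\<^bsub>P\<^esub> c g \<otimes>\<^bsub>P\<^esub> c g')"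
    have F: "t r \<in> carrier F" "?t \<in> carrier F" "?t' \<in> carrier F"
      using t(1) r s s' by blast+
    have "inv ?t \<otimes> (?t \<otimes> (g' \<otimes> inv ?t')) = g' \<otimes> inv ?t'"
      using F g' by (simp flip: m_assoc)
    then have "t r \<otimes> (g \<otimes> g') \<otimes> inv ?t' = (t r \<otimes> g \<otimes> inv ?t) \<otimes> (?t \<otimes> g' \<otimes> inv ?t')"
      using F g g' by (simp add: m_assoc)
    moreover have "r \<otimes>\<^bsub>P\<^esub> c (g \<otimes> g') = r \<otimes>\<^bsub>P\<^esub> c g \<otimes>\<^bsub>P\<^esub> c g'"
      using g g' r by (simp add: c.H.m_assoc)
    ultimately show "u (g \<otimes> g') r = u g r \<otimes>\<^bsub>A\<^esub> u g' (r \<otimes>\<^bsub>P\<^esub> c g)"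
      unfolding u_def A_simps using F g g' by (simp only: f.hom_mult m_closed inv_closed)
  qed
  have lc_u: "locally_constant T (\<lambda>g. restrict (u g) (carrier P))"
  proof (rule locally_constant_cong)
    have "locally_constant T (\<lambda>g. (f g, c g))"
      using f c by (intro locally_constant_pair) (simp_all add: finite_quotient_map_def)
    then show "locally_constant T (\<lambda>g. case (f g, c g) of (q, p) \<Rightarrow>
        \<lambda>r\<in>carrier P. f (t r) \<otimes>\<^bsub>Q\<^esub> q \<otimes>\<^bsub>Q\<^esub> inv\<^bsub>Q\<^esub> f (t (r \<otimes>\<^bsub>P\<^esub> p)))"
      by (rule locally_constant_compose)
    show "(case (f g, c g) of (q, p) \<Rightarrow>
        \<lambda>r\<in>carrier P. f (t r) \<otimes>\<^bsub>Q\<^esub> q \<otimes>\<^bsub>Q\<^esub> inv\<^bsub>Q\<^esub> f (t (r \<otimes>\<^bsub>P\<^esub> p))) =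
        restrict (u g) (carrier P)" if "g \<in> topspace T" for g
      using that t by (auto simp: u_def intro!: restrict_ext)
  qed

  \<comment> \<open>The values of \<open>u\<close> on generators are placed in layer 0 of
    \<open>P'\<close> over \<open>P\<close>, with trivial values elsewhere, so that products over
    fibres return them.\<close>
  define w where "w y = (\<lambda>(p, i). if i = (0::int) then u y p else \<one>\<^bsub>A\<^esub>)" for y
  have w_closed: "w y r \<in> carrier A" if "y \<in> X" "r \<in> carrier P'" for y r
    using that cocycle_closed[OF u X_closed] by (auto simp: w_def P'_car)
  have fin_w: "finite {y \<in> X. \<exists>r\<in>carrier P'. w y r \<noteq> \<one>\<^bsub>A\<^esub>}"
  proof (rule finite_subset[OF _ finite_nontrivial_generators[OF f]], rule subsetI, rule ccontr)
    fix y assume "y \<in> {y \<in> X. \<exists>r\<in>carrier P'. w y r \<noteq> \<one>\<^bsub>A\<^esub>}"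
      and y': "y \<notin> {y \<in> X. f y \<noteq> \<one>\<^bsub>Q\<^esub>}"
    then obtain p i where y: "y \<in> X" and pi: "(p, i) \<in> carrier P'" and ne: "w y (p, i) \<noteq> \<one>\<^bsub>A\<^esub>"
      by auto
    have fy: "f y = \<one>\<^bsub>Q\<^esub>" using y y' by simp
    have yF: "y \<in> carrier F" using X_closed[OF y] .
    have "f y = f \<one>" using fy by simp
    then have "y \<in> K"
      using yF subgroup.one_closed[OF subgroup_D] unfolding K_def by blast
    then have "c y = \<one>\<^bsub>P\<^esub>" using c1 yF by blast
    then have "u y p = \<one>\<^bsub>A\<^esub>"
      using pi fy t yF by (simp add: u_def P'_car A_simps)
    then show False using ne by (simp add: w_def split: if_splits)
  qed
  obtain b where b: "cocycle F P' A f' b" "locally_constant T (\<lambda>g. restrict (b g) (carrier P'))"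
    and bX: "\<And>y r. y \<in> X \<Longrightarrow> r \<in> carrier P' \<Longrightarrow> b y r = w y r"
    and bD: "\<And>d r. d \<in> D (Suc ?k) \<Longrightarrow> r \<in> carrier P' \<Longrightarrow> b d r = \<one>\<^bsub>A\<^esub>"
    using cocycle_exists[OF f' A_sigma A_comm w_closed fin_w f'D] by blast
  have b_closed: "b g (p, i) \<in> carrier A" if "g \<in> carrier F" "p \<in> carrier P" "i \<in> {0..<int M}" for g p i
    using cocycle_closed[OF b(1)] that by (simp add: P'_car)

  \<comment> \<open>The product over a fibre of \<open>P'\<close> over \<open>P\<close>. Translation
    by \<open>f' g\<close> carries fibres to fibres, shifting the cyclic coordinate by
    \<open>z g\<close>, so \<open>v\<close> is again a cocycle.\<close>
  define v where "v g p = finprod A (\<lambda>i. b g (p, i)) {0..<int M}" for g p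
  have v: "cocycle F P A c v"
    unfolding cocycle_def
  proof (intro conjI ballI)
    fix g r assume g: "g \<in> carrier F" and r: "r \<in> carrier P"
    then show "v g r \<in> carrier A"
      unfolding v_def by (intro A.finprod_closed) (auto intro!: b_closed)
    fix g' assume g': "g' \<in> carrier F"
    have s: "r \<otimes>\<^bsub>P\<^esub> c g \<in> carrier P" using g r by simp
    let ?s = "\<lambda>i. (i + z g) mod int M"
    have bij: "bij_betw ?s {0..<int M} {0..<int M}"
      by (rule bij_betw_byWitness[where f' = "\<lambda>i. (i - z g) mod int M"])
        (use M in \<open>auto simp: mod_simps\<close>)
    have "v (g \<otimes> g') r = finprod A (\<lambda>i. b g (r, i) \<otimes>\<^bsub>A\<^esub> b g' (r \<otimes>\<^bsub>P\<^esub> c g, ?s i)) {0..<int M}"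
      unfolding v_def
    proof (rule A.finprod_cong')
      show "b (g \<otimes> g') (r, i) = b g (r, i) \<otimes>\<^bsub>A\<^esub> b g' (r \<otimes>\<^bsub>P\<^esub> c g, ?s i)"
        if "i \<in> {0..<int M}" for i
      proof -
        have "(r, i) \<in> carrier P'" using r that by (simp add: P'_car)
        from cocycle_mult[OF b(1) g g' this] show ?thesis by (simp add: P'_def f'_def)
      qed
    qed (use g g' r s M in \<open>auto intro!: A.m_closed b_closed\<close>)
    also have "\<dots> = v g r \<otimes>\<^bsub>A\<^esub> finprod A (\<lambda>i. b g' (r \<otimes>\<^bsub>P\<^esub> c g, ?s i)) {0..<int M}"
      unfolding v_def using g g' r s M by (intro A.finprod_multf) (auto intro!: b_closed)
    also have "finprod A (\<lambda>i. b g' (r \<otimes>\<^bsub>P\<^esub> c g, ?s i)) {0..<int M} = v g' (r \<otimes>\<^bsub>P\<^esub> c g)"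
    proof -
      have "finprod A (\<lambda>i. b g' (r \<otimes>\<^bsub>P\<^esub> c g, i)) (?s ` {0..<int M}) =
          finprod A (\<lambda>i. b g' (r \<otimes>\<^bsub>P\<^esub> c g, ?s i)) {0..<int M}"
        using bij g' s M by (intro A.finprod_reindex) (auto intro!: b_closed simp: bij_betw_def)
      then show ?thesis
        using bij by (simp add: v_def bij_betw_def)
    qed
    finally show "v (g \<otimes> g') r = v g r \<otimes>\<^bsub>A\<^esub> v g' (r \<otimes>\<^bsub>P\<^esub> c g)" .
  qed
  have lc_v: "locally_constant T (\<lambda>g. restrict (v g) (carrier P))"
  proof (rule locally_constant_cong)
    show "locally_constant T (\<lambda>g. (\<lambda>\<beta>. \<lambda>p\<in>carrier P. finprod A (\<lambda>i. \<beta> (p, i)) {0..<int M})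
        (restrict (b g) (carrier P')))"
      by (rule locally_constant_compose[OF b(2)])
    show "(\<lambda>\<beta>. \<lambda>p\<in>carrier P. finprod A (\<lambda>i. \<beta> (p, i)) {0..<int M}) (restrict (b g) (carrier P')) =
        restrict (v g) (carrier P)" if "g \<in> topspace T" for g
      using that unfolding v_def
      by (intro restrict_ext A.finprod_cong') (auto simp: P'_car intro!: b_closed)
  qed
  have "v y r = u y r" if y: "y \<in> X" and r: "r \<in> carrier P" for y r
  proof -
    have "v y r = finprod A (\<lambda>i. if 0 = i then u y r else \<one>\<^bsub>A\<^esub>) {0..<int M}"
      unfolding v_def using bX[OF y] r cocycle_closed[OF u X_closed[OF y] r]
      by (intro A.finprod_cong') (auto simp: P'_car w_def)
    also have "\<dots> = u y r"
      using M cocycle_closed[OF u X_closed[OF y] r] by (intro A.finprod_singleton) auto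
    finally show ?thesis .
  qed
  then have vu: "v h r = u h r" if "r \<in> carrier P" for r
    using cocycle_agree[OF c A_group v lc_v u lc_u _ hF that] by blast

  \<comment> \<open>As \<open>f' h\<close> is trivial, the two values of \<open>b ?y\<close> in the
    commutation relation have the same argument and cancel.\<close>
  have per: "b h (r \<otimes>\<^bsub>P'\<^esub> f' ?y) = b h r" if r: "r \<in> carrier P'" for r
  proof -
    have "b h r \<otimes>\<^bsub>A\<^esub> b ?y (r \<otimes>\<^bsub>P'\<^esub> f' h) = b ?y r \<otimes>\<^bsub>A\<^esub> b h (r \<otimes>\<^bsub>P'\<^esub> f' ?y)"
      by (rule cocycle_commute[OF f' A_group b(1) f'D bD hF yF commh r])
    moreover have "r \<otimes>\<^bsub>P'\<^esub> f' h = r" using r by (simp add: f'h)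
    moreover have cl: "b h r \<in> carrier A" "b ?y r \<in> carrier A" "b h (r \<otimes>\<^bsub>P'\<^esub> f' ?y) \<in> carrier A"
      using r cocycle_closed[OF b(1)] hF yF by auto
    ultimately have "b h (r \<otimes>\<^bsub>P'\<^esub> f' ?y) \<otimes>\<^bsub>A\<^esub> b ?y r = b h r \<otimes>\<^bsub>A\<^esub> b ?y r"
      by (metis A.m_comm)
    then show ?thesis
      using cl by simp
  qed
  have per_pow: "b h (r \<otimes>\<^bsub>P'\<^esub> f' ?y [^]\<^bsub>P'\<^esub> i) = b h r" if r: "r \<in> carrier P'" for r and i :: nat
  proof (induction i)
    case 0
    then show ?case using r by simp
  next
    case (Suc i)
    then show ?case
      using per[of "r \<otimes>\<^bsub>P'\<^esub> f' ?y [^]\<^bsub>P'\<^esub> i"] r yF by (simp add: f'.H.m_assoc)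
  qed
  have y_pow: "f' ?y [^]\<^bsub>P'\<^esub> card (carrier P) = (\<one>\<^bsub>P\<^esub>, int d mod int M)"
  proof -
    have "f' ?y [^]\<^bsub>P'\<^esub> card (carrier P) = f' (x [^] d)"
      using xF by (simp add: d_def f'.hom_nat_pow[symmetric] nat_pow_pow)
    moreover have "c (x [^] d) = \<one>\<^bsub>P\<^esub>"
      using xF c.H.pow_order_eq_1[of "c x"] unfolding Coset.order_def
      by (simp add: c.hom_nat_pow d_def mult.commute[of n] flip: c.H.nat_pow_pow)
    moreover have "z (x [^] d) = int d mod int M"
      using xF by (simp add: z.hom_nat_pow zx mod_mult_right_eq)
    ultimately show ?thesis by (simp add: f'_def)
  qed
  have shift: "b h (p, (i + int d) mod int M) = b h (p, i)" if "p \<in> carrier P" "i \<in> {0..<int M}" for p i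
  proof -
    have "(p, i) \<in> carrier P'" using that by (simp add: P'_car)
    from per_pow[OF this, of "card (carrier P)"] show ?thesis
      unfolding y_pow using that(1) by (simp add: P'_def mod_add_right_eq)
  qed
  have v1: "v h p = \<one>\<^bsub>A\<^esub>" if p: "p \<in> carrier P" for p
  proof -
    \<comment> \<open>Reduction modulo \<open>M\<close> extends the values on the fibre to a
      function on all integers with periods \<open>d\<close> and \<open>M\<close>.\<close>
    let ?\<gamma> = "\<lambda>i. b h (p, i mod int M)"
    have "v h p = finprod A ?\<gamma> {0..<int M}"
      unfolding v_def using p hF M by (intro A.finprod_cong') (auto intro!: b_closed)
    also have "\<dots> = \<one>\<^bsub>A\<^esub>"
    proof (rule A.finprod_periodic[OF _ finA d M_def])
      show "?\<gamma> i \<in> carrier A" for i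
        using p hF M by (intro b_closed) auto
      show "?\<gamma> (i + int d) = ?\<gamma> i" for i
        using shift[OF p, of "i mod int M"] M by (simp add: mod_add_left_eq)
    qed simp
    finally show ?thesis .
  qed
  \<comment> \<open>With \<open>c h\<close> trivial, the value of \<open>u h\<close> at the identity
    is a conjugate of \<open>f h\<close>.\<close>
  have "c h = \<one>\<^bsub>P\<^esub>"
    using f'h by (simp add: f'_def P'_def)
  then have "u h \<one>\<^bsub>P\<^esub> = f (t \<one>\<^bsub>P\<^esub>) \<otimes>\<^bsub>Q\<^esub> f h \<otimes>\<^bsub>Q\<^esub> inv\<^bsub>Q\<^esub> f (t \<one>\<^bsub>P\<^esub>)"
    using t[of "\<one>\<^bsub>P\<^esub>"] hF by (simp add: u_def)
  moreover have "u h \<one>\<^bsub>P\<^esub> = \<one>\<^bsub>Q\<^esub>"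
    using v1[of "\<one>\<^bsub>P\<^esub>"] vu[of "\<one>\<^bsub>P\<^esub>"] by (simp add: A_simps)
  ultimately have "f (t \<one>\<^bsub>P\<^esub>) \<otimes>\<^bsub>Q\<^esub> f h \<otimes>\<^bsub>Q\<^esub> inv\<^bsub>Q\<^esub> f (t \<one>\<^bsub>P\<^esub>) = \<one>\<^bsub>Q\<^esub>" by simp
  moreover have tQ: "f (t \<one>\<^bsub>P\<^esub>) \<in> carrier Q" "f h \<in> carrier Q"
    using t(1)[of "\<one>\<^bsub>P\<^esub>"] hF by simp_all
  ultimately have "f (t \<one>\<^bsub>P\<^esub>) \<otimes>\<^bsub>Q\<^esub> f h = f (t \<one>\<^bsub>P\<^esub>)"
    using f.H.inv_solve_right'[OF f.H.one_closed, of "f (t \<one>\<^bsub>P\<^esub>) \<otimes>\<^bsub>Q\<^esub> f h" "f (t \<one>\<^bsub>P\<^esub>)"] by simp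
  then have "f h = \<one>\<^bsub>Q\<^esub>"
    using tQ by simp
  then have "h \<in> N" using f1[OF hF] by simp
  then show thesis using that unfolding h_def by blast
qed

text \<open>The preceding result with the kernel of \<open>f\<close> as open normal
  subgroup.\<close>

lemma image_eq_power:
  fixes n :: nat
  assumes m: "m \<ge> 2" and f: "finite_quotient_map \<Sigma> F T Q f" and fD: "\<And>d. d \<in> D m \<Longrightarrow> f d = \<one>\<^bsub>Q\<^esub>"
    and x: "x \<in> X" and g: "g \<in> carrier F" and n: "n > 0"
    and comm: "g \<otimes> x [^] n \<otimes> inv g \<otimes> inv (x [^] n) \<in> D m"
  obtains a :: int where "f g = f (x [^] a)"
proof -
  interpret f: group_hom F Q f using group_hom_finite_quotient_map[OF f] .
  obtain j where j: "m = Suc (Suc j)"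
    using m by (metis add_2_eq_Suc le_Suc_ex)
  let ?N = "{g \<in> carrier F. f g = \<one>\<^bsub>Q\<^esub>}"
  have "D m \<subseteq> ?N" using fD D_subset by blast
  then obtain a :: int where "g \<otimes> inv (x [^] a) \<in> ?N"
    using in_open_normal_times_power[OF normal_open_kernel[OF f] _ x g n, of j] comm j by blast
  then have "f g = f (x [^] a)"
    using g X_closed[OF x] f.H.inv_solve_right'[of "\<one>\<^bsub>Q\<^esub>" "f g" "f (x [^] a)"] by simp
  then show thesis using that by blast
qed

end

section \<open>Free pro-\<open>\<Sigma>\<close> groups of rank one\<close>

text \<open>Compare multiplicities, using for each prime the largest power that divides
  \<open>n\<close>.\<close>

lemma dvd_int_if_prime_powers_dvd:
  fixes n :: nat and \<delta> :: int
  assumes "n > 0" "\<And>l k. Factorial_Ring.prime l \<Longrightarrow> l ^ k dvd n \<Longrightarrow> int (l ^ k) dvd \<delta>"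
  shows "int n dvd \<delta>"
proof (cases "\<delta> = 0")
  case False
  have "n dvd nat \<bar>\<delta>\<bar>"
  proof (rule multiplicity_le_imp_dvd)
    show "n \<noteq> 0" using assms(1) by simp
    fix p :: nat assume p: "Factorial_Ring.prime p"
    have "int (p ^ multiplicity p n) dvd \<delta>"
      using p by (rule assms(2)) (rule multiplicity_dvd)
    then have "p ^ multiplicity p n dvd nat \<bar>\<delta>\<bar>"
      by (simp add: nat_abs_dvd_iff dvd_nat_abs_iff del: of_nat_power)
    then show "multiplicity p n \<le> multiplicity p (nat \<bar>\<delta>\<bar>)"
      using False p by (intro multiplicity_geI) (auto simp: prime_gt_Suc_0_nat not_prime_unit)
  qed
  then show ?thesis by (simp add: dvd_nat_abs_iff)
qed simp

lemma (in group) int_pow_eq_if_card_dvd: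
  assumes "finite (carrier G)" "y \<in> carrier G" "int (card (carrier G)) dvd a - b"
  shows "y [^] (a :: int) = y [^] b"
proof -
  obtain s where s: "a = b + int (card (carrier G)) * s"
    using assms(3) by (metis add_diff_cancel_left' dvd_def diff_add_cancel add.commute)
  have "y [^] int (card (carrier G)) = \<one>"
    using pow_order_eq_1[OF assms(2)] unfolding Coset.order_def by (simp add: int_pow_int)
  then have "y [^] (int (card (carrier G)) * s) = \<one>"
    using assms(2) by (simp flip: int_pow_pow)
  then show ?thesis
    using s assms(2) by (simp add: int_pow_mult)
qed

section \<open>Coordinates on the l-adic integers and on their product\<close>

lemma carrier_adic_integers:
  "y \<in> carrier (adic_integers l) \<longleftrightarrow>
     (\<forall>k. y k \<in> carrier (integer_mod_group (l ^ k))) \<and> (\<forall>i j. i \<le> j \<longrightarrow> y j mod int (l ^ i) = y i)"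
  by (auto simp: adic_integers_def inverse_limit_def PiE_iff)

lemma mult_adic_integers:
  "y \<otimes>\<^bsub>adic_integers l\<^esub> y' = (\<lambda>k. (y k + y' k) mod int (l ^ k))"
  by (simp add: adic_integers_def inverse_limit_def fun_eq_iff)

lemma topspace_adic_topology [simp]: "topspace (adic_topology l) = carrier (adic_integers l)"
  unfolding adic_topology_def inverse_limit_topology_def adic_integers_def[symmetric]
  by (auto simp: carrier_adic_integers PiE_iff)

lemma Hausdorff_Z_sigma_topology: "Hausdorff_space (Z_sigma_topology \<Sigma>)"
  unfolding Z_sigma_topology_def adic_topology_def inverse_limit_topology_def
  by (simp add: Hausdorff_space_product_topology Hausdorff_space_subtopology)

lemma continuous_map_adic_topology:
  assumes "f \<in> topspace T \<rightarrow> carrier (adic_integers l)"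
    and "\<And>k. continuous_map T (discrete_topology (carrier (integer_mod_group (l ^ k)))) (\<lambda>x. f x k)"
  shows "continuous_map T (adic_topology l) f"
  using assms unfolding adic_topology_def inverse_limit_topology_def adic_integers_def[symmetric]
  by (simp add: continuous_map_in_subtopology continuous_map_componentwise_UNIV image_subset_iff Pi_iff)

context free_pro_sigma
begin

text \<open>The preimage of the subgroup generated by \<open>f x\<close> is closed and contains the
  only topological generator.\<close>

lemma image_cyclic_if_singleton:
  assumes X: "X = {x}" and f: "finite_quotient_map \<Sigma> F T Q f" and g: "g \<in> carrier F"
  obtains a :: int where "f g = f (x [^] a)"
proof -
  interpret f: group_hom F Q f using group_hom_finite_quotient_map[OF f] .
  have xF: "x \<in> carrier F" using X X_closed by simp
  have C: "subgroup (generate Q {f x}) Q"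
    using xF by (intro f.H.generate_is_subgroup) simp
  interpret C: subgroup "generate Q {f x}" Q by (rule C)
  let ?S = "{g \<in> carrier F. f g \<in> generate Q {f x}}"
  have "?S = carrier F"
  proof (rule closed_subgroup_eq_carrier)
    show "subgroup ?S F"
      by (rule subgroupI) (auto intro!: exI[of _ \<one>])
    show "closedin T ?S"
      using locally_constant_closedin[of T f] f by (simp add: finite_quotient_map_def)
    show "X \<subseteq> ?S" using X xF by (simp add: generate.incl)
  qed
  then have "f g \<in> generate Q {f x}" using g by blast
  then show thesis
    using that f.H.generate_pow[of "f x"] xF by (auto simp: f.hom_int_pow)
qed

text \<open>The isomorphism collects the exponent maps modulo all prime powers from \<Sigma>. Finite
  quotients separate points and see only exponents modulo their order, which gives injectivity. The
  Chinese remainder theorem handles finitely many coordinates at once, and compactness then gives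
  surjectivity.\<close>

lemma isomorphic_Z_sigma:
  assumes X: "X = {x}"
  shows "topologically_isomorphic F T (Z_sigma \<Sigma>) (Z_sigma_topology \<Sigma>)"
proof -
  have xF: "x \<in> carrier F" using X X_closed by simp
  define sig where "sig M \<longleftrightarrow> M > 0 \<and> (\<forall>p. Factorial_Ring.prime p \<and> p dvd M \<longrightarrow> p \<in> \<Sigma>)" for M :: nat
  have "\<exists>z. sig M \<longrightarrow> finite_quotient_map \<Sigma> F T (integer_mod_group M) z \<and> z x = 1 mod int M" for M
  proof (cases "sig M")
    case True
    then show ?thesis
      using hom_to_cyclic[of M x] X unfolding sig_def by (metis insertI1)
  qed simp
  then obtain \<zeta> where \<zeta>: "\<And>M. sig M \<Longrightarrow> finite_quotient_map \<Sigma> F T (integer_mod_group M) (\<zeta> M)"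
    "\<And>M. sig M \<Longrightarrow> \<zeta> M x = 1 mod int M" by metis
  have \<zeta>_pow: "\<zeta> M (x [^] (a :: int)) = a mod int M" if "sig M" for M a
    using group_hom.hom_int_pow[OF group_hom_finite_quotient_map[OF \<zeta>(1)[OF that]] xF] \<zeta>(2)[OF that]
    by (simp add: int_pow_integer_mod_group mod_mult_right_eq)
  \<comment> \<open>Cyclicity is applied to the pair of \<open>f\<close> and
    \<open>\<zeta> M\<close>, so that one exponent serves both.\<close>
  have approx: "\<exists>a :: int. f g = f (x [^] a) \<and> \<zeta> M g = a mod int M"
    if "sig M" "finite_quotient_map \<Sigma> F T Q f" "g \<in> carrier F" for M g and Q :: "('q, 'r) monoid_scheme" and f
    using image_cyclic_if_singleton[OF X finite_quotient_map_pair[OF that(2) \<zeta>(1)[OF that(1)]] that(3)]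
      \<zeta>_pow[OF that(1)] by (metis Pair_inject)
  have compat: "\<zeta> M g mod int M' = \<zeta> M' g" if "sig M" "sig M'" "M' dvd M" "g \<in> carrier F" for M M' g
    using approx[OF that(2) \<zeta>(1)[OF that(1)] that(4)] \<zeta>_pow[OF that(1)] that(3)
    by (auto simp: mod_mod_cancel)
  have sig_pow: "sig (l ^ k)" if "l \<in> \<Sigma>" for l k
    unfolding sig_def
  proof (intro conjI allI impI)
    show "l ^ k > 0" using sigma_prime[OF that] by (simp add: prime_gt_0_nat)
    fix p assume "Factorial_Ring.prime p \<and> p dvd l ^ k"
    then have "p = l"
      using sigma_prime[OF that] by (metis prime_dvd_power_nat primes_dvd_imp_eq)
    then show "p \<in> \<Sigma>" using that by simp
  qed
  have \<zeta>_hom: "\<zeta> M \<in> hom F (integer_mod_group M)" "locally_constant T (\<zeta> M)" if "sig M" for M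
    using \<zeta>(1)[OF that] by (simp_all add: finite_quotient_map_def)

  define \<theta> where "\<theta> g = (\<lambda>l\<in>\<Sigma>. \<lambda>k. \<zeta> (l ^ k) g)" for g
  have \<theta>_adic: "(\<lambda>k. \<zeta> (l ^ k) g) \<in> carrier (adic_integers l)" if "g \<in> carrier F" "l \<in> \<Sigma>" for g l
    unfolding carrier_adic_integers
    using that hom_in_carrier[OF \<zeta>_hom(1)[OF sig_pow]] compat[OF sig_pow sig_pow le_imp_power_dvd]
    by blast
  have carZ: "carrier (Z_sigma \<Sigma>) = (\<Pi>\<^sub>E l\<in>\<Sigma>. carrier (adic_integers l))"
    by (simp add: Z_sigma_def)
  have topZ: "topspace (Z_sigma_topology \<Sigma>) = carrier (Z_sigma \<Sigma>)"
    by (simp add: Z_sigma_topology_def carZ)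
  have hom: "\<theta> \<in> hom F (Z_sigma \<Sigma>)"
  proof (rule homI)
    show "\<theta> g \<in> carrier (Z_sigma \<Sigma>)" if "g \<in> carrier F" for g
      using \<theta>_adic[OF that] by (auto simp: carZ \<theta>_def)
    show "\<theta> (g \<otimes> h) = \<theta> g \<otimes>\<^bsub>Z_sigma \<Sigma>\<^esub> \<theta> h" if "g \<in> carrier F" "h \<in> carrier F" for g h
      using hom_mult[OF \<zeta>_hom(1)[OF sig_pow] that]
      by (auto simp: \<theta>_def Z_sigma_def mult_adic_integers fun_eq_iff)
  qed
  have cont: "continuous_map T (Z_sigma_topology \<Sigma>) \<theta>"
    unfolding Z_sigma_topology_def continuous_map_componentwise
  proof (intro conjI ballI)
    show "\<theta> ` topspace T \<subseteq> extensional \<Sigma>" by (auto simp: \<theta>_def)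
    fix l assume l: "l \<in> \<Sigma>"
    have "continuous_map T (discrete_topology (carrier (integer_mod_group (l ^ k)))) (\<zeta> (l ^ k))" for k
      using hom_in_carrier[OF \<zeta>_hom(1)[OF sig_pow[OF l]]] locally_constantD'[OF \<zeta>_hom(2)[OF sig_pow[OF l]]]
      by (auto simp: continuous_map_def)
    then have "continuous_map T (adic_topology l) (\<lambda>g k. \<zeta> (l ^ k) g)"
      using \<theta>_adic l by (intro continuous_map_adic_topology) auto
    then show "continuous_map T (adic_topology l) (\<lambda>g. \<theta> g l)"
      using l by (simp add: \<theta>_def)
  qed
  have inj: "inj_on \<theta> (carrier F)"
  proof (rule inj_onI, rule ccontr)
    fix g h assume g: "g \<in> carrier F" and h: "h \<in> carrier F" and eq: "\<theta> g = \<theta> h" and ne: "g \<noteq> h"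
    have "closedin T {h}"
      using compact_Hausdorff(2) h by (simp add: closedin_Hausdorff_singleton)
    then have "openin T (carrier F - {h})" by (metis openin_diff openin_topspace topspace_eq)
    then obtain Q :: "nat monoid" and \<pi> where Q: "finite_quotient_map \<Sigma> F T Q \<pi>"
      and "\<And>u. u \<in> carrier F \<Longrightarrow> \<pi> u = \<pi> g \<Longrightarrow> u \<in> carrier F - {h}"
      using neighbourhood_contains_fibre[of "carrier F - {h}" g] g ne by blast
    then have ne': "\<pi> g \<noteq> \<pi> h" using h by fastforce
    interpret \<pi>: group_hom F Q \<pi> using group_hom_finite_quotient_map[OF Q] .
    have finQ: "finite (carrier Q)" using Q by (simp add: finite_quotient_map_def finite_sigma_group_def)
    let ?o = "card (carrier Q)"
    have o: "sig ?o"
      using Q finQ \<pi>.H.one_closed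
      by (auto simp: sig_def finite_quotient_map_def finite_sigma_group_def card_gt_0_iff)
    obtain a b :: int where ab: "\<pi> g = \<pi> (x [^] a)" "\<zeta> ?o g = a mod int ?o"
      "\<pi> h = \<pi> (x [^] b)" "\<zeta> ?o h = b mod int ?o"
      using approx[OF o Q g] approx[OF o Q h] by blast
    \<comment> \<open>\<open>\<theta>\<close> records only prime power moduli; the congruence modulo
      the order of \<open>Q\<close> is assembled from them.\<close>
    have "int ?o dvd \<zeta> ?o g - \<zeta> ?o h"
    proof (rule dvd_int_if_prime_powers_dvd)
      show "?o > 0" using o by (simp add: sig_def)
      fix l k assume l: "Factorial_Ring.prime l" "l ^ k dvd ?o"
      show "int (l ^ k) dvd \<zeta> ?o g - \<zeta> ?o h"
      \<comment> \<open>For \<open>k = 0\<close> the prime \<open>l\<close> may lie outside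
        \<Sigma>, but the modulus is 1.\<close>
      proof (cases "k = 0")
        case False
        then have "l dvd ?o" using l(2) by (metis dvd_power dvd_trans gr0I)
        then have l\<Sigma>: "l \<in> \<Sigma>" using o l(1) by (auto simp: sig_def)
        then have "\<zeta> (l ^ k) g = \<zeta> (l ^ k) h"
          using fun_cong[OF fun_cong[OF eq], of l k] by (simp add: \<theta>_def)
        then have "\<zeta> ?o g mod int (l ^ k) = \<zeta> ?o h mod int (l ^ k)"
          using compat[OF o sig_pow[OF l\<Sigma>] l(2)] g h by simp
        then show ?thesis by (simp add: mod_eq_dvd_iff)
      qed simp
    qed
    then have "int ?o dvd a - b"
      using ab by (simp add: mod_eq_dvd_iff[symmetric] mod_diff_eq dvd_eq_mod_eq_0)
    then have "\<pi> (x [^] a) = \<pi> (x [^] b)"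
      using \<pi>.H.int_pow_eq_if_card_dvd[OF finQ] xF by (simp add: \<pi>.hom_int_pow)
    then show False using ab ne' by simp
  qed
  have surj: "\<theta> ` carrier F = carrier (Z_sigma \<Sigma>)"
  proof
    show "\<theta> ` carrier F \<subseteq> carrier (Z_sigma \<Sigma>)" using hom by (auto simp: hom_def)
    show "carrier (Z_sigma \<Sigma>) \<subseteq> \<theta> ` carrier F"
    proof
      fix y assume y: "y \<in> carrier (Z_sigma \<Sigma>)"
      have ya: "y l \<in> carrier (adic_integers l)" if "l \<in> \<Sigma>" for l
        using y that by (auto simp: carZ)
      \<comment> \<open>The closed set of elements with the prescribed coordinate at
        \<open>(l, k)\<close>. A common point of all these sets is a preimage of
        \<open>y\<close>.\<close>
      let ?C = "\<lambda>(l, k). {g \<in> carrier F. \<zeta> (l ^ k) g \<in> {y l k}}"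
      have "\<Inter> (?C ` (\<Sigma> \<times> UNIV)) \<noteq> {}"
      proof (rule compact_space_fip[THEN iffD1, OF compact_Hausdorff(1), rule_format], intro conjI ballI allI impI)
        fix C assume "C \<in> ?C ` (\<Sigma> \<times> UNIV)"
        then obtain l k where "l \<in> \<Sigma>" "C = {g \<in> carrier F. \<zeta> (l ^ k) g \<in> {y l k}}"
          by auto
        then show "closedin T C"
          using locally_constant_closedin[OF \<zeta>_hom(2)[OF sig_pow[of l k]], of "{y l k}"] by simp
      next
        fix \<F> assume "finite \<F> \<and> \<F> \<subseteq> ?C ` (\<Sigma> \<times> UNIV)"
        then obtain J where J: "finite J" "J \<subseteq> \<Sigma> \<times> UNIV" "\<F> = ?C ` J"
          by (meson finite_subset_image)
        \<comment> \<open>One exponent above all those in \<open>J\<close>, so each prime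
          contributes a single congruence. The representatives \<open>y l K\<close> are nonnegative,
          hence \<open>nat\<close> loses nothing.\<close>
        define K where "K = Max (insert 0 (snd ` J))"
        have K: "k \<le> K" if "(l, k) \<in> J" for l k
          unfolding K_def using J(1) that by (intro Max_ge) (auto simp: image_iff intro!: bexI[of _ "(l, k)"])
        have "\<exists>a. \<forall>l\<in>fst ` J. [a = nat (y l K)] (mod (l ^ K))"
        proof (rule chinese_remainder_nat)
          show "\<forall>i\<in>fst ` J. \<forall>j\<in>fst ` J. i \<noteq> j \<longrightarrow> coprime (i ^ K) (j ^ K)"
            using J(2) sigma_prime by (auto intro!: primes_coprime)
        qed (use J in simp)
        then obtain a where a: "\<And>l. l \<in> fst ` J \<Longrightarrow> [a = nat (y l K)] (mod (l ^ K))" by blast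
        have "x [^] int a \<in> ?C p" if "p \<in> J" for p
        proof -
          obtain l k where p: "p = (l, k)" by (rule prod.exhaust)
          have lk: "(l, k) \<in> J" using that p by simp
          then have l: "l \<in> \<Sigma>" using J(2) by auto
          have yK: "y l K \<ge> 0" "y l K mod int (l ^ k) = y l k"
            using ya[OF l] K[OF lk] sig_pow[OF l, of K]
            by (auto simp: carrier_adic_integers carrier_integer_mod_group sig_def split: if_splits)
          have "[a = nat (y l K)] (mod (l ^ K))" using a lk by force
          then have "[int a = y l K] (mod int (l ^ K))"
            using yK(1) cong_int_iff[of a "nat (y l K)" "l ^ K"] by simp
          moreover have "int (l ^ k) dvd int (l ^ K)"
            using K[OF lk] by (simp add: le_imp_power_dvd)
          ultimately have "[int a = y l K] (mod int (l ^ k))"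
            by (rule cong_dvd_modulus)
          then show ?thesis
            using \<zeta>_pow[OF sig_pow[OF l], of k "int a"] yK(2) xF by (simp add: cong_def p)
        qed
        then have "x [^] int a \<in> \<Inter> \<F>" unfolding J(3) by (rule INT_I)
        then show "\<Inter> \<F> \<noteq> {}" by blast
      qed
      then obtain g where g: "\<And>l k. l \<in> \<Sigma> \<Longrightarrow> g \<in> carrier F \<and> \<zeta> (l ^ k) g = y l k" by auto
      then have "g \<in> carrier F" using sigma_nonempty by blast
      moreover have "y = \<theta> g"
        using y g by (auto simp: \<theta>_def carZ PiE_iff extensional_def fun_eq_iff)
      ultimately show "y \<in> \<theta> ` carrier F" by blast
    qed
  qed
  have "homeomorphic_map T (Z_sigma_topology \<Sigma>) \<theta>"
    by (rule continuous_imp_homeomorphic_map[OF cont compact_Hausdorff(1) Hausdorff_Z_sigma_topology])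
      (simp_all add: surj inj topZ)
  moreover have "\<theta> \<in> iso F (Z_sigma \<Sigma>)"
    using hom inj surj by (simp add: iso_def bij_betw_def)
  ultimately show ?thesis
    unfolding topologically_isomorphic_def by blast
qed

end

section \<open>Centralizers in the maximal \<open>m\<close>-step solvable quotient\<close>

text \<open>Commuting with an element and with its inverse are equivalent, which reduces integer
  exponents to natural ones.\<close>

lemma (in group) commute_int_pow_iff:
  assumes "g \<in> carrier G" "x \<in> carrier G"
  shows "g \<otimes> x [^] (n :: int) = x [^] n \<otimes> g \<longleftrightarrow> g \<otimes> x [^] nat \<bar>n\<bar> = x [^] nat \<bar>n\<bar> \<otimes> g"
proof (cases "n < 0")
  case True
  let ?y = "x [^] nat \<bar>n\<bar>"
  have y: "?y \<in> carrier G" and eq: "x [^] n = inv ?y"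
    using assms True int_pow_neg_int[OF assms(2), of "nat \<bar>n\<bar>"] by simp_all
  have "g \<otimes> inv ?y = inv ?y \<otimes> g \<longleftrightarrow> g = inv ?y \<otimes> g \<otimes> ?y"
    using assms y by (intro inv_solve_right') auto
  also have "\<dots> \<longleftrightarrow> g = inv ?y \<otimes> (g \<otimes> ?y)"
    using assms y by (simp add: m_assoc)
  also have "\<dots> \<longleftrightarrow> g \<otimes> ?y = ?y \<otimes> g"
    using assms y by (intro inv_solve_left) auto
  finally show ?thesis by (simp only: eq)
next
  case False
  then show ?thesis
    using int_pow_int[of G x "nat \<bar>n\<bar>"] by simp
qed

lemma (in group) commutator_eq_one_iff:
  assumes "g \<in> carrier G" "y \<in> carrier G"
  shows "g \<otimes> y \<otimes> inv g \<otimes> inv y = \<one> \<longleftrightarrow> g \<otimes> y = y \<otimes> g"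
  using assms inv_solve_right'[of "\<one>" "g \<otimes> y \<otimes> inv g" y] inv_solve_right'[of y "g \<otimes> y" g] by simp

section \<open>Commutation and closures in the quotient by \<open>D m\<close>\<close>

context pro_sigma
begin

abbreviation proj :: "nat \<Rightarrow> 'a \<Rightarrow> 'a set" where
  "proj \<equiv> solvable_quotient_proj F T"

lemma carrier_solvable_quotient: "carrier (solvable_quotient F T m) = proj m ` carrier F"
  by (simp add: solvable_quotient_def carrier_FactGroup solvable_quotient_proj_def)

lemma group_hom_proj: "group_hom F (solvable_quotient F T m) (proj m)"
proof -
  interpret N: normal "D m" F by (rule normal_D)
  have "proj m \<in> hom F (solvable_quotient F T m)"
    using N.r_coset_hom_Mod by (simp add: solvable_quotient_def solvable_quotient_proj_def [abs_def])
  then show ?thesis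
    using N.factorgroup_is_group
    by (simp add: group_hom_def group_hom_axioms_def group_axioms solvable_quotient_def)
qed

lemma proj_eq_one_iff:
  assumes "g \<in> carrier F"
  shows "proj m g = \<one>\<^bsub>solvable_quotient F T m\<^esub> \<longleftrightarrow> g \<in> D m"
  using assms normal_D subgroup_D coset_join1 coset_join2 D_subset
  unfolding solvable_quotient_def solvable_quotient_proj_def one_FactGroup by metis

lemma proj_commute_iff:
  assumes "g \<in> carrier F" "y \<in> carrier F"
  shows "proj m g \<otimes>\<^bsub>solvable_quotient F T m\<^esub> proj m y = proj m y \<otimes>\<^bsub>solvable_quotient F T m\<^esub> proj m g
    \<longleftrightarrow> g \<otimes> y \<otimes> inv g \<otimes> inv y \<in> D m"
proof -
  interpret q: group_hom F "solvable_quotient F T m" "proj m" by (rule group_hom_proj)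
  have "g \<otimes> y \<otimes> inv g \<otimes> inv y \<in> D m \<longleftrightarrow>
      proj m (g \<otimes> y \<otimes> inv g \<otimes> inv y) = \<one>\<^bsub>solvable_quotient F T m\<^esub>"
    using assms by (simp only: proj_eq_one_iff m_closed inv_closed)
  then show ?thesis
    using assms q.H.commutator_eq_one_iff[of "proj m g" "proj m y"] by simp
qed

lemma openin_solvable_quotient_topology:
  "openin (solvable_quotient_topology F T m) U \<longleftrightarrow>
     U \<subseteq> proj m ` carrier F \<and> openin T {g \<in> carrier F. proj m g \<in> U}"
  by (simp add: solvable_quotient_topology_def openin_quotient_topology carrier_FactGroup
      solvable_quotient_proj_def)

lemma topspace_solvable_quotient_topology:
  "topspace (solvable_quotient_topology F T m) = proj m ` carrier F"
proof -
  have "{g \<in> carrier F. proj m g \<in> proj m ` carrier F} = topspace T" by auto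
  then have "openin (solvable_quotient_topology F T m) (proj m ` carrier F)"
    unfolding openin_solvable_quotient_topology by (metis openin_topspace order_refl)
  then show ?thesis
    by (metis openin_subset openin_topspace openin_solvable_quotient_topology subset_antisym)
qed

text \<open>Replaces the quotient topology by the open normal subgroups of \<open>F\<close> above
  \<open>D m\<close>, the form in which \<open>in_open_normal_times_power\<close> is stated.\<close>

lemma proj_in_closure_iff:
  assumes g: "g \<in> carrier F" and x: "x \<in> carrier F"
  shows "proj m g \<in> topologically_generated (solvable_quotient F T m) (solvable_quotient_topology F T m)
           {proj m x} \<longleftrightarrow>
    (\<forall>N. N \<lhd> F \<and> openin T N \<and> D m \<subseteq> N \<longrightarrow> (\<exists>a :: int. g \<otimes> inv (x [^] a) \<in> N))"
    (is "?L \<longleftrightarrow> ?R")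
proof -
  let ?G = "solvable_quotient F T m"
  interpret q: group_hom F ?G "proj m" by (rule group_hom_proj)
  have gen: "generate ?G {proj m x} = {proj m (x [^] (a :: int)) | a. True}"
    using q.H.generate_pow[of "proj m x"] x by (simp add: q.hom_int_pow)
  have L: "?L \<longleftrightarrow> (\<forall>V. proj m g \<in> V \<and> openin (solvable_quotient_topology F T m) V \<longrightarrow>
      (\<exists>a :: int. proj m (x [^] a) \<in> V))"
    using g unfolding topologically_generated_def in_closure_of topspace_solvable_quotient_topology gen by auto
  show ?thesis
  proof
    assume l: ?L
    show ?R
    proof (intro allI impI, elim conjE)
      fix N assume N: "N \<lhd> F" "openin T N" "D m \<subseteq> N"
      define Q f where "Q = F Mod N" and "f = (\<lambda>g. N #> g)"
      have f: "finite_quotient_map \<Sigma> F T Q f"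
        unfolding Q_def f_def using finite_quotient_map_Mod N by blast
      interpret f: group_hom F Q f using group_hom_finite_quotient_map[OF f] .
      have f_eq: "f u = f v \<longleftrightarrow> u \<otimes> inv v \<in> N" if "u \<in> carrier F" "v \<in> carrier F" for u v
        using r_coset_eq_iff[OF normal_imp_subgroup[OF N(1)] that] by (simp add: f_def)
      \<comment> \<open>Since \<open>N\<close> contains \<open>D m\<close>, the fibre of
        \<open>f\<close> through \<open>g\<close> is a union of cosets of \<open>D m\<close>; its
        image is therefore open.\<close>
      let ?V = "proj m ` {u \<in> carrier F. f u = f g}"
      have sat: "f v = f g" if v: "v \<in> carrier F" "proj m v \<in> ?V" for v
      proof -
        obtain u where u: "u \<in> carrier F" "f u = f g" "proj m v = proj m u" using v(2) by auto
        then have "proj m (v \<otimes> inv u) = \<one>\<^bsub>?G\<^esub>" using v(1) by simp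
        then have "v \<otimes> inv u \<in> N"
          using proj_eq_one_iff[of "v \<otimes> inv u" m] u(1) v(1) N(3) by blast
        then show ?thesis using f_eq[OF v(1) u(1)] u(2) by blast
      qed
      have V: "{v \<in> carrier F. proj m v \<in> ?V} = {v \<in> carrier F. f v \<in> {f g}}"
        using sat by blast
      have "openin T {v \<in> carrier F. f v \<in> {f g}}"
        using f by (intro locally_constantD') (simp add: finite_quotient_map_def)
      then have "openin (solvable_quotient_topology F T m) ?V"
        unfolding openin_solvable_quotient_topology V by blast
      moreover have "proj m g \<in> ?V" using g by blast
      ultimately obtain a :: int where "proj m (x [^] a) \<in> ?V"
        using l[unfolded L, rule_format, of ?V] by blast
      then have "f (x [^] a) = f g" using sat x by simp
      then show "\<exists>a :: int. g \<otimes> inv (x [^] a) \<in> N"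
        using f_eq[of g "x [^] a"] g x by auto
    qed
  next
    assume r: ?R
    show ?L
      unfolding L
    proof (intro allI impI, elim conjE)
      fix V assume V: "proj m g \<in> V" "openin (solvable_quotient_topology F T m) V"
      let ?W = "{u \<in> carrier F. proj m u \<in> V}"
      have W: "openin T ?W" "g \<in> ?W"
        using V g by (simp_all add: openin_solvable_quotient_topology)
      obtain Q :: "nat monoid" and \<pi> where Q: "finite_quotient_map \<Sigma> F T Q \<pi>"
        and fib: "\<And>u. u \<in> carrier F \<Longrightarrow> \<pi> u = \<pi> g \<Longrightarrow> u \<in> ?W"
        using neighbourhood_contains_fibre[OF W] by metis
      interpret \<pi>: group_hom F Q \<pi> using group_hom_finite_quotient_map[OF Q] .
      \<comment> \<open>The hypothesis is applied to the saturation of \<open>D m\<close>. It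
        matches \<open>g\<close> with a power of \<open>x\<close> up to some \<open>d\<close> in
        \<open>D m\<close>, which disappears in the quotient.\<close>
      have "D m \<subseteq> {g \<in> carrier F. \<pi> g \<in> \<pi> ` D m}" using D_subset by blast
      then obtain a :: int where "\<pi> (g \<otimes> inv (x [^] a)) \<in> \<pi> ` D m"
        using r normal_open_saturation[OF Q] by blast
      then obtain d where d: "d \<in> D m" "\<pi> (g \<otimes> inv (x [^] a)) = \<pi> d" by blast
      have dF: "d \<in> carrier F" using d(1) D_subset by blast
      have "\<pi> (d \<otimes> x [^] a) = \<pi> (g \<otimes> inv (x [^] a)) \<otimes>\<^bsub>Q\<^esub> \<pi> (x [^] a)"
        using d(2) dF x by simp
      also have "\<dots> = \<pi> g"
        using g x by (simp flip: \<pi>.hom_mult add: m_assoc)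
      finally have "proj m (d \<otimes> x [^] a) \<in> V" using fib[of "d \<otimes> x [^] a"] dF x by simp
      moreover have "proj m d = \<one>\<^bsub>?G\<^esub>" using proj_eq_one_iff[OF dF] d(1) by blast
      then have "proj m (d \<otimes> x [^] a) = proj m (x [^] a)"
        using dF x by simp
      ultimately show "\<exists>a :: int. proj m (x [^] a) \<in> V" by auto
    qed
  qed
qed

end

section \<open>Centralizers of powers of generators, and slimness\<close>

context free_pro_sigma
begin

text \<open>Both sides reduce to one condition on the open normal subgroups above
  \<open>D m\<close>. One direction is \<open>in_open_normal_times_power\<close>; for the other,
  \<open>g\<close> is a power of \<open>x\<close> modulo each such subgroup and so commutes there
  with powers of \<open>x\<close>.\<close>

lemma centralizer_power:
  assumes m: "m \<ge> 2" and x: "x \<in> X" and n: "n \<noteq> (0 :: int)"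
  shows "centralizer (solvable_quotient F T m) {proj m x [^]\<^bsub>solvable_quotient F T m\<^esub> n} =
    topologically_generated (solvable_quotient F T m) (solvable_quotient_topology F T m) {proj m x}"
proof -
  let ?G = "solvable_quotient F T m"
  interpret q: group_hom F ?G "proj m" by (rule group_hom_proj)
  have xF: "x \<in> carrier F" using X_closed[OF x] .
  let ?n = "nat \<bar>n\<bar>"
  have n': "?n > 0" using n by simp
  have "proj m g \<in> centralizer ?G {proj m x [^]\<^bsub>?G\<^esub> n} \<longleftrightarrow>
      proj m g \<in> topologically_generated ?G (solvable_quotient_topology F T m) {proj m x}"
    if g: "g \<in> carrier F" for g
  proof -
    have "proj m g \<in> centralizer ?G {proj m x [^]\<^bsub>?G\<^esub> n} \<longleftrightarrow>
        proj m g \<otimes>\<^bsub>?G\<^esub> proj m (x [^] ?n) = proj m (x [^] ?n) \<otimes>\<^bsub>?G\<^esub> proj m g"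
      using g xF q.H.commute_int_pow_iff[of "proj m g" "proj m x" n]
      by (simp only: q.hom_nat_pow q.hom_closed) (simp add: centralizer_def)
    also have "\<dots> \<longleftrightarrow> g \<otimes> x [^] ?n \<otimes> inv g \<otimes> inv (x [^] ?n) \<in> D m"
      using g xF by (intro proj_commute_iff) auto
    also have "\<dots> \<longleftrightarrow> (\<forall>N. N \<lhd> F \<and> openin T N \<and> D m \<subseteq> N \<longrightarrow> (\<exists>a :: int. g \<otimes> inv (x [^] a) \<in> N))"
    proof (intro iffI allI impI, elim conjE)
      fix N assume comm: "g \<otimes> x [^] ?n \<otimes> inv g \<otimes> inv (x [^] ?n) \<in> D m"
        and N: "N \<lhd> F" "openin T N" "D m \<subseteq> N"
      obtain j where "m = Suc (Suc j)" using m by (metis add_2_eq_Suc le_Suc_ex)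
      then show "\<exists>a :: int. g \<otimes> inv (x [^] a) \<in> N"
        using in_open_normal_times_power[of N j x g ?n] N x g n' comm by metis
    next
      assume *: "\<forall>N. N \<lhd> F \<and> openin T N \<and> D m \<subseteq> N \<longrightarrow> (\<exists>a :: int. g \<otimes> inv (x [^] a) \<in> N)"
      show "g \<otimes> x [^] ?n \<otimes> inv g \<otimes> inv (x [^] ?n) \<in> D m"
      proof (rule in_D_if_in_open_normal)
        show "g \<otimes> x [^] ?n \<otimes> inv g \<otimes> inv (x [^] ?n) \<in> carrier F" using g xF by simp
        fix N assume N: "N \<lhd> F" "openin T N" "D m \<subseteq> N"
        then obtain a :: int where a: "g \<otimes> inv (x [^] a) \<in> N" using * by blast
        let ?y = "x [^] ?n"
        have yF: "?y \<in> carrier F" using xF by simp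
        define Q f where "Q = F Mod N" and "f = (\<lambda>g. N #> g)"
        have "finite_quotient_map \<Sigma> F T Q f"
          unfolding Q_def f_def using finite_quotient_map_Mod N by blast
        then interpret f: group_hom F Q f by (rule group_hom_finite_quotient_map)
        have "f g = f (x [^] a)"
          using r_coset_eq_iff[OF normal_imp_subgroup[OF N(1)]] a g xF by (simp add: f_def)
        moreover have "x [^] a \<otimes> ?y = ?y \<otimes> x [^] a"
          using xF by (metis int_pow_int int_pow_mult add.commute)
        ultimately have "f g \<otimes>\<^bsub>Q\<^esub> f ?y = f ?y \<otimes>\<^bsub>Q\<^esub> f g"
          using xF yF by (metis f.hom_mult int_pow_closed)
        then have "f (g \<otimes> ?y \<otimes> inv g \<otimes> inv ?y) = \<one>\<^bsub>Q\<^esub>"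
          using f.H.commutator_eq_one_iff[of "f g" "f ?y"] g yF
          by (simp only: f.hom_mult f.hom_inv f.hom_closed m_closed inv_closed)
        then show "g \<otimes> ?y \<otimes> inv g \<otimes> inv ?y \<in> N"
          using r_coset_eq_self_iff[OF normal_imp_subgroup[OF N(1)], of "g \<otimes> ?y \<otimes> inv g \<otimes> inv ?y"] g yF
          by (simp only: f_def Q_def one_FactGroup m_closed inv_closed)
      qed
    qed
    also have "\<dots> \<longleftrightarrow> proj m g \<in> topologically_generated ?G (solvable_quotient_topology F T m) {proj m x}"
      using proj_in_closure_iff[OF g xF] by simp
    finally show ?thesis .
  qed
  moreover have "centralizer ?G {proj m x [^]\<^bsub>?G\<^esub> n} \<subseteq> proj m ` carrier F"
    unfolding centralizer_def carrier_solvable_quotient by blast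
  moreover have "topologically_generated ?G (solvable_quotient_topology F T m) {proj m x} \<subseteq> proj m ` carrier F"
    unfolding topologically_generated_def
    by (metis closure_of_subset_topspace topspace_solvable_quotient_topology)
  ultimately show ?thesis by blast
qed

text \<open>Modulo \<open>N\<close> the element is a power of \<open>x\<close>. Its exponent is a
  multiple of the order of \<open>Q\<close>, because the exponent sum in \<open>x\<close> vanishes
  on an element that also looks like a power of \<open>y\<close>.\<close>

lemma commute_with_two_powers:
  fixes n :: nat
  assumes m: "m \<ge> 2" and x: "x \<in> X" and y: "y \<in> X" and xy: "x \<noteq> y" and g: "g \<in> carrier F" and n: "n > 0"
    and comm_x: "g \<otimes> x [^] n \<otimes> inv g \<otimes> inv (x [^] n) \<in> D m"
    and comm_y: "g \<otimes> y [^] n \<otimes> inv g \<otimes> inv (y [^] n) \<in> D m"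
  shows "g \<in> D m"
proof (rule in_D_if_in_open_normal[OF g])
  fix N assume N: "N \<lhd> F" "openin T N" "D m \<subseteq> N"
  have xF: "x \<in> carrier F" and yF: "y \<in> carrier F" using x y X_closed by auto
  define Q f where "Q = F Mod N" and "f = (\<lambda>g. N #> g)"
  have f: "finite_quotient_map \<Sigma> F T Q f"
    unfolding Q_def f_def using finite_quotient_map_Mod N by blast
  interpret f: group_hom F Q f using group_hom_finite_quotient_map[OF f] .
  have f1: "f u = \<one>\<^bsub>Q\<^esub> \<longleftrightarrow> u \<in> N" if "u \<in> carrier F" for u
    using r_coset_eq_self_iff[OF normal_imp_subgroup[OF N(1)] that] by (simp add: f_def Q_def)
  have fD: "f d = \<one>\<^bsub>Q\<^esub>" if "d \<in> D m" for d
    using that N(3) D_subset f1[of d] by blast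
  have finQ: "finite (carrier Q)" using f by (simp add: finite_quotient_map_def finite_sigma_group_def)
  let ?o = "card (carrier Q)"
  have o: "?o > 0" using finQ f.H.one_closed by (auto simp: card_gt_0_iff)
  obtain z where z: "finite_quotient_map \<Sigma> F T (integer_mod_group ?o) z" "z x = 1 mod int ?o"
    and zy: "\<And>y. y \<in> X \<Longrightarrow> y \<noteq> x \<Longrightarrow> z y = 0" and zD: "\<And>k d. d \<in> D (Suc k) \<Longrightarrow> z d = 0"
    using hom_to_cyclic[OF o _ x] f unfolding finite_quotient_map_def finite_sigma_group_def by metis
  interpret z: group_hom F "integer_mod_group ?o" z using group_hom_finite_quotient_map[OF z(1)] .
  have zD': "z d = \<one>\<^bsub>integer_mod_group ?o\<^esub>" if "d \<in> D m" for d
    using that zD[of d "m - 1"] m by simp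
  have "(f d, z d) = \<one>\<^bsub>Q \<times>\<times> integer_mod_group ?o\<^esub>" if "d \<in> D m" for d
    using fD zD' that by simp
  \<comment> \<open>Pairing \<open>f\<close> with \<open>z\<close> ties the exponent in
    \<open>Q\<close> to the value of the exponent sum.\<close>
  then obtain a :: int where "(f g, z g) = (f (x [^] a), z (x [^] a))"
    using image_eq_power[OF m finite_quotient_map_pair[OF f z(1)] _ x g n comm_x] by blast
  then have a: "f g = f (x [^] a)" "z g = a mod int ?o"
    using xF z(2) by (simp_all add: z.hom_int_pow int_pow_integer_mod_group mod_mult_right_eq)
  obtain b :: int where "z g = z (y [^] b)"
    using image_eq_power[OF m z(1) zD' y g n comm_y] by blast
  then have "z g = 0"
    using zy[OF y] xy yF by (simp add: z.hom_int_pow int_pow_integer_mod_group)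
  then have "f g = f x [^]\<^bsub>Q\<^esub> (0 :: int)"
    using a xF f.H.int_pow_eq_if_card_dvd[OF finQ, of "f x" a 0] by (simp add: f.hom_int_pow dvd_eq_mod_eq_0)
  then show "g \<in> N" using f1[OF g] by simp
qed

text \<open>The hypothesis excludes a single generator. Without generators \<open>F\<close> is
  trivial; with two, the preimage of an open subgroup contains a common power of both.\<close>

lemma slim_solvable_quotient:
  assumes m: "m \<ge> 2" and niso: "\<not> topologically_isomorphic F T (Z_sigma \<Sigma>) (Z_sigma_topology \<Sigma>)"
  shows "slim (solvable_quotient F T m) (solvable_quotient_topology F T m)"
  unfolding slim_def
proof (intro allI impI, elim conjE)
  let ?G = "solvable_quotient F T m"
  fix H assume H: "subgroup H ?G" "openin (solvable_quotient_topology F T m) H"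
  interpret q: group_hom F ?G "proj m" by (rule group_hom_proj)
  interpret H: subgroup H ?G by (rule H(1))
  have "g \<in> D m" if g: "g \<in> carrier F" and cent: "proj m g \<in> centralizer ?G H" for g
  proof (cases "X = {}")
    case True
    have "{\<one>} = carrier F"
      using True compact_Hausdorff(2)
      by (intro closed_subgroup_eq_carrier) (auto simp: closedin_Hausdorff_singleton triv_subgroup)
    then show ?thesis
      using g subgroup.one_closed[OF subgroup_D[of m]] by (metis singletonD)
  next
    case False
    then obtain x where x: "x \<in> X" by blast
    then obtain y where y: "y \<in> X" "x \<noteq> y"
      using niso isomorphic_Z_sigma by blast
    let ?W = "{u \<in> carrier F. proj m u \<in> H}"
    have W: "openin T ?W" "\<one> \<in> ?W"
      using H(2) by (simp_all add: openin_solvable_quotient_topology)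
    obtain Q :: "nat monoid" and \<pi> where Q: "finite_quotient_map \<Sigma> F T Q \<pi>"
      and fib: "\<And>u. u \<in> carrier F \<Longrightarrow> \<pi> u = \<pi> \<one> \<Longrightarrow> u \<in> ?W"
      using neighbourhood_contains_fibre[OF W] by blast
    interpret \<pi>: group_hom F Q \<pi> using group_hom_finite_quotient_map[OF Q] .
    \<comment> \<open>The kernel of \<open>\<pi>\<close> maps into \<open>H\<close>, and raising to
      the order of \<open>Q\<close> sends every generator into that kernel.\<close>
    let ?n = "card (carrier Q)"
    have n: "?n > 0"
      using Q \<pi>.H.one_closed by (auto simp: finite_quotient_map_def finite_sigma_group_def card_gt_0_iff)
    have "g \<otimes> u [^] ?n \<otimes> inv g \<otimes> inv (u [^] ?n) \<in> D m" if u: "u \<in> X" for u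
    proof -
      have uF: "u \<in> carrier F" using X_closed[OF u] .
      have "\<pi> (u [^] ?n) = \<pi> \<one>"
        using \<pi>.H.pow_order_eq_1[of "\<pi> u"] uF unfolding Coset.order_def by (simp add: \<pi>.hom_nat_pow)
      then have "proj m (u [^] ?n) \<in> H" using fib[of "u [^] ?n"] uF by simp
      then show ?thesis
        using cent g uF by (subst proj_commute_iff[symmetric]) (auto simp: centralizer_def)
    qed
    then show ?thesis
      using commute_with_two_powers[OF m x y(1) y(2) g n] x y(1) by blast
  qed
  then have "centralizer ?G H \<subseteq> {\<one>\<^bsub>?G\<^esub>}"
    using proj_eq_one_iff unfolding centralizer_def carrier_solvable_quotient by blast
  moreover have "\<one>\<^bsub>?G\<^esub> \<in> centralizer ?G H"
    using H.subset by (auto simp: centralizer_def)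
  ultimately show "centralizer ?G H = {\<one>\<^bsub>?G\<^esub>}" by blast
qed

end

theorem theorem2:
  fixes \<Sigma> :: "nat set" and F :: "'a monoid" and T :: "'a topology" and X :: "'a set" and m :: nat
  assumes "\<Sigma> \<noteq> {}" and "\<forall>p\<in>\<Sigma>. Factorial_Ring.prime p"
    and "free_pro_sigma_group \<Sigma> F T X"
    and "m \<ge> 2"
  shows "(\<forall>n::int. \<forall>x\<in>X. n \<noteq> 0 \<longrightarrow>
            centralizer (solvable_quotient F T m)
              {solvable_quotient_proj F T m x [^]\<^bsub>solvable_quotient F T m\<^esub> n}
            = topologically_generated (solvable_quotient F T m) (solvable_quotient_topology F T m)
                {solvable_quotient_proj F T m x})
       \<and> (\<not> topologically_isomorphic F T (Z_sigma \<Sigma>) (Z_sigma_topology \<Sigma>) \<longrightarrow>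
            slim (solvable_quotient F T m) (solvable_quotient_topology F T m))"
proof -
  interpret free_pro_sigma \<Sigma> F T X
    using assms by unfold_locales auto
  show ?thesis
    using centralizer_power[OF assms(4)] slim_solvable_quotient[OF assms(4)] by blast
qed

end
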